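(* Let $\pi$ be a conformal anti-invariant $\xi^\perp$-submersion from a Sasakian manifold $(M,\phi,\xi,\eta,g_M)$ to a Riemannian manifold $(N,g_N)$. Then $\pi$ is a totally geodesic map if and only if the following three conditions hold: (a) $T_U\phi V=0$ and $\mathcal{H}\nabla_U\phi V\in\Gamma(\phi\ker\pi_* )$ for all $U,V\in\Gamma(\ker\pi_* )$; (b) $\pi$ is a horizontally homothetic map; (c) $A_Z\phi V=0$ and $\mathcal{H}\nabla_Z\phi V\in\Gamma(\phi\ker\pi_* )$ for all $Z\in\Gamma((\ker\pi_* )^\perp)$ and $V\in\Gamma(\ker\pi_* )$.
   Context: Everything is smooth. An almost contact metric manifold $(M,\phi,\xi,\eta,g_M)$ is a Riemannian manifold with a $(1,1)$-tensor field $\phi$, a vector field $\xi$ and a 1-form $\eta$ with $\phi\xi=0$, $\eta\circ\phi=0$, $\eta(\xi)=1$, $\phi^2=-I+\eta\otimes\xi$, $g_M(\phi X,\phi Y)=g_M(X,Y)-\eta(X)\eta(Y)$. It is Sasakian (in the sign convention used here) if $(\nabla_X\phi)Y=-g_M(X,Y)\xi+\eta(Y)X$ and $\nabla_X\xi=\phi X$, with $\nabla$ the Levi-Civita connection of $g_M$. A horizontally conformal submersion $\pi:(M,g_M)\to(N,g_N)$ with dilation $\lambda$ ($\lambda$ a positive function on $M$) is a submersion with $\lambda^2g_M(X,Y)=g_N(\pi_*X,\pi_*Y)$ for all $X,Y\in\Gamma((\ker\pi_* )^\perp)$; it is horizontally homothetic if $\mathcal{H}(\mathrm{grad}\,\lambda)=0$.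 A conformal anti-invariant $\xi^\perp$-submersion is a horizontally conformal submersion from an almost contact metric manifold to a Riemannian manifold such that $\xi$ is normal to $\ker\pi_*$ and $\phi(\ker\pi_* )\subset(\ker\pi_* )^\perp$. $\mathcal{V},\mathcal{H}$ are the projections onto $\ker\pi_*$ and $(\ker\pi_* )^\perp$; O'Neill's tensors are $A_EF=\mathcal{V}\nabla_{\mathcal{H}E}\mathcal{H}F+\mathcal{H}\nabla_{\mathcal{H}E}\mathcal{V}F$ and $T_EF=\mathcal{H}\nabla_{\mathcal{V}E}\mathcal{V}F+\mathcal{V}\nabla_{\mathcal{V}E}\mathcal{H}F$. With $\nabla^\pi$ the pullback to $\pi^{-1}TN$ of the Levi-Civita connection of $N$, the second fundamental form of $\pi$ is $(\nabla\pi_* )(X,Y)=\nabla^\pi_X\pi_*Y-\pi_*(\nabla_XY)$ for $X,Y\in\Gamma(TM)$, and $\pi$ is totally geodesic if $\nabla\pi_*=0$. *)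

theory Defs
  imports "HOL-Analysis.Analysis" "HOL-Library.Function_Algebras"
begin

section \<open>Functions form a real vector space\<close>

instantiation "fun" :: (type, scaleR) scaleR
begin

definition scaleR_fun_def: "r *\<^sub>R f = (\<lambda>x. r *\<^sub>R f x)"

instance ..

end

lemma scaleR_fun_apply [simp]: "(r *\<^sub>R f) x = r *\<^sub>R f x"
  by (simp add: scaleR_fun_def)

instance "fun" :: (type, real_vector) real_vector
  by standard (simp_all add: fun_eq_iff scaleR_add_right scaleR_add_left)


section \<open>Smooth manifolds\<close>

text \<open>\<open>Ck_on k f S\<close> is meant for open \<open>S\<close>: all iterated directional derivatives up to order
  \<open>k\<close> exist as Frechet derivatives and are continuous.\<close>

primrec Ck_on :: "nat \<Rightarrow> ('a::real_normed_vector \<Rightarrow> 'b::real_normed_vector) \<Rightarrow> 'a set \<Rightarrow> bool"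
where
  "Ck_on 0 f S \<longleftrightarrow> continuous_on S f"
| "Ck_on (Suc k) f S \<longleftrightarrow>
     (\<forall>x\<in>S. f differentiable (at x)) \<and> (\<forall>v. Ck_on k (\<lambda>x. frechet_derivative f (at x) v) S)"

definition smooth_on :: "'a set \<Rightarrow> ('a::real_normed_vector \<Rightarrow> 'b::real_normed_vector) \<Rightarrow> bool"
  where "smooth_on S f \<longleftrightarrow> (\<forall>k. Ck_on k f S)"

type_synonym ('m, 'e) chart = "'m set \<times> ('m \<Rightarrow> 'e)"

text \<open>The underlying set of a manifold is a whole (Hausdorff, second countable) type; the smooth
  structure is given by an atlas, not required to be maximal, with values in a Euclidean space
  \<open>'e\<close>, so the dimension is \<open>DIM('e)\<close>.\<close>

definition smooth_manifold ::
  "('m::{t2_space, second_countable_topology}, 'e::euclidean_space) chart set \<Rightarrow> bool"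
where
  "smooth_manifold A \<longleftrightarrow>
     (\<Union>(U, c)\<in>A. U) = UNIV \<and>
     (\<forall>(U, c)\<in>A. open U \<and> open (c ` U) \<and> homeomorphism U (c ` U) c (inv_into U c)) \<and>
     (\<forall>(U, c)\<in>A. \<forall>(V, d)\<in>A. smooth_on (c ` (U \<inter> V)) (d \<circ> inv_into U c))"

definition smooth_fun :: "('m, 'e::euclidean_space) chart set \<Rightarrow> ('m \<Rightarrow> real) \<Rightarrow> bool"
  where "smooth_fun A f \<longleftrightarrow> (\<forall>(U, c)\<in>A. smooth_on (c ` U) (f \<circ> inv_into U c))"

definition smooth_map ::
  "('m::topological_space, 'a::euclidean_space) chart set \<Rightarrow>
   ('n::topological_space, 'b::euclidean_space) chart set \<Rightarrow> ('m \<Rightarrow> 'n) \<Rightarrow> bool"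
where
  "smooth_map A B F \<longleftrightarrow> continuous_on UNIV F \<and>
     (\<forall>(U, c)\<in>A. \<forall>(V, d)\<in>B. smooth_on (c ` (U \<inter> F -` V)) (d \<circ> F \<circ> inv_into U c))"


section \<open>Tangent vectors and vector fields\<close>

text \<open>Tangent vectors at \<open>p\<close> are the derivations at \<open>p\<close> of the algebra of smooth functions. As
  HOL functions are total, a derivation is set to zero on non-smooth arguments, so that equality of
  tangent vectors is equality of HOL functions.\<close>

type_synonym 'm tvec = "('m \<Rightarrow> real) \<Rightarrow> real"
type_synonym 'm vfield = "'m \<Rightarrow> 'm tvec"

definition tangent_space :: "('m, 'e::euclidean_space) chart set \<Rightarrow> 'm \<Rightarrow> 'm tvec set"
where
  "tangent_space A p = {v.
     (\<forall>f h. smooth_fun A f \<longrightarrow> smooth_fun A h \<longrightarrow> v (f + h) = v f + v h) \<and>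
     (\<forall>a f. smooth_fun A f \<longrightarrow> v (a *\<^sub>R f) = a * v f) \<and>
     (\<forall>f h. smooth_fun A f \<longrightarrow> smooth_fun A h \<longrightarrow> v (f * h) = f p * v h + h p * v f) \<and>
     (\<forall>f. \<not> smooth_fun A f \<longrightarrow> v f = 0)}"

definition vector_fields :: "('m, 'e::euclidean_space) chart set \<Rightarrow> 'm vfield set"
where
  "vector_fields A = {X. (\<forall>p. X p \<in> tangent_space A p) \<and>
     (\<forall>f. smooth_fun A f \<longrightarrow> smooth_fun A (\<lambda>p. X p f))}"

definition sections_of ::
  "('m, 'e::euclidean_space) chart set \<Rightarrow> ('m \<Rightarrow> 'm tvec set) \<Rightarrow> 'm vfield set"
  where "sections_of A S = {X \<in> vector_fields A. \<forall>p. X p \<in> S p}"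

definition lie_bracket :: "'m vfield \<Rightarrow> 'm vfield \<Rightarrow> 'm vfield"
  where "lie_bracket X Y = (\<lambda>p f. X p (\<lambda>q. Y q f) - Y p (\<lambda>q. X q f))"

definition linear_at ::
  "('m, 'e::euclidean_space) chart set \<Rightarrow> 'm \<Rightarrow> ('m tvec \<Rightarrow> 'v::real_vector) \<Rightarrow> bool"
where
  "linear_at A p L \<longleftrightarrow>
     (\<forall>u\<in>tangent_space A p. \<forall>v\<in>tangent_space A p. L (u + v) = L u + L v) \<and>
     (\<forall>a. \<forall>u\<in>tangent_space A p. L (a *\<^sub>R u) = a *\<^sub>R L u)"

definition one_form :: "('m, 'e::euclidean_space) chart set \<Rightarrow> ('m \<Rightarrow> 'm tvec \<Rightarrow> real) \<Rightarrow> bool"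
where
  "one_form A \<eta> \<longleftrightarrow> (\<forall>p. linear_at A p (\<eta> p)) \<and>
     (\<forall>X\<in>vector_fields A. smooth_fun A (\<lambda>p. \<eta> p (X p)))"

definition apply_endo :: "('m \<Rightarrow> 'm tvec \<Rightarrow> 'm tvec) \<Rightarrow> 'm vfield \<Rightarrow> 'm vfield"
  where "apply_endo \<phi> X = (\<lambda>p. \<phi> p (X p))"

definition tensor_field_1_1 ::
  "('m, 'e::euclidean_space) chart set \<Rightarrow> ('m \<Rightarrow> 'm tvec \<Rightarrow> 'm tvec) \<Rightarrow> bool"
where
  "tensor_field_1_1 A \<phi> \<longleftrightarrow>
     (\<forall>p. linear_at A p (\<phi> p) \<and> \<phi> p ` tangent_space A p \<subseteq> tangent_space A p) \<and>
     (\<forall>X\<in>vector_fields A. apply_endo \<phi> X \<in> vector_fields A)"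


section \<open>Riemannian metrics and the Levi-Civita connection\<close>

definition riemannian_metric ::
  "('m, 'e::euclidean_space) chart set \<Rightarrow> ('m \<Rightarrow> 'm tvec \<Rightarrow> 'm tvec \<Rightarrow> real) \<Rightarrow> bool"
where
  "riemannian_metric A g \<longleftrightarrow>
     (\<forall>p. \<forall>u\<in>tangent_space A p. linear_at A p (g p u)) \<and>
     (\<forall>p. \<forall>u\<in>tangent_space A p. \<forall>v\<in>tangent_space A p. g p u v = g p v u) \<and>
     (\<forall>p. \<forall>u\<in>tangent_space A p. u \<noteq> 0 \<longrightarrow> g p u u > 0) \<and>
     (\<forall>X\<in>vector_fields A. \<forall>Y\<in>vector_fields A. smooth_fun A (\<lambda>p. g p (X p) (Y p)))"

definition riemannian_manifold ::
  "('m::{t2_space, second_countable_topology}, 'e::euclidean_space) chart set \<Rightarrow>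
   ('m \<Rightarrow> 'm tvec \<Rightarrow> 'm tvec \<Rightarrow> real) \<Rightarrow> bool"
  where "riemannian_manifold A g \<longleftrightarrow> smooth_manifold A \<and> riemannian_metric A g"

definition affine_connection ::
  "('m, 'e::euclidean_space) chart set \<Rightarrow> ('m vfield \<Rightarrow> 'm vfield \<Rightarrow> 'm vfield) \<Rightarrow> bool"
where
  "affine_connection A D \<longleftrightarrow>
     (\<forall>X\<in>vector_fields A. \<forall>Y\<in>vector_fields A. D X Y \<in> vector_fields A) \<and>
     (\<forall>X\<in>vector_fields A. \<forall>X'\<in>vector_fields A. \<forall>Y\<in>vector_fields A.
        D (X + X') Y = D X Y + D X' Y) \<and>
     (\<forall>f. \<forall>X\<in>vector_fields A. \<forall>Y\<in>vector_fields A. smooth_fun A f \<longrightarrow>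
        D (\<lambda>p. f p *\<^sub>R X p) Y = (\<lambda>p. f p *\<^sub>R D X Y p)) \<and>
     (\<forall>X\<in>vector_fields A. \<forall>Y\<in>vector_fields A. \<forall>Y'\<in>vector_fields A.
        D X (Y + Y') = D X Y + D X Y') \<and>
     (\<forall>f. \<forall>X\<in>vector_fields A. \<forall>Y\<in>vector_fields A. smooth_fun A f \<longrightarrow>
        D X (\<lambda>p. f p *\<^sub>R Y p) = (\<lambda>p. X p f *\<^sub>R Y p + f p *\<^sub>R D X Y p))"

definition levi_civita ::
  "('m, 'e::euclidean_space) chart set \<Rightarrow> ('m \<Rightarrow> 'm tvec \<Rightarrow> 'm tvec \<Rightarrow> real) \<Rightarrow>
   ('m vfield \<Rightarrow> 'm vfield \<Rightarrow> 'm vfield) \<Rightarrow> bool"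
where
  "levi_civita A g D \<longleftrightarrow> affine_connection A D \<and>
     (\<forall>X\<in>vector_fields A. \<forall>Y\<in>vector_fields A. D X Y - D Y X = lie_bracket X Y) \<and>
     (\<forall>X\<in>vector_fields A. \<forall>Y\<in>vector_fields A. \<forall>Z\<in>vector_fields A. \<forall>p.
        X p (\<lambda>q. g q (Y q) (Z q)) = g p (D X Y p) (Z p) + g p (Y p) (D X Z p))"

definition gradient ::
  "('m, 'e::euclidean_space) chart set \<Rightarrow> ('m \<Rightarrow> 'm tvec \<Rightarrow> 'm tvec \<Rightarrow> real) \<Rightarrow>
   ('m \<Rightarrow> real) \<Rightarrow> 'm vfield"
where
  "gradient A g f p =
     (THE v. v \<in> tangent_space A p \<and> (\<forall>w\<in>tangent_space A p. g p v w = w f))"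


section \<open>Sasakian manifolds\<close>

definition almost_contact_metric ::
  "('m, 'e::euclidean_space) chart set \<Rightarrow> ('m \<Rightarrow> 'm tvec \<Rightarrow> 'm tvec) \<Rightarrow> 'm vfield \<Rightarrow>
   ('m \<Rightarrow> 'm tvec \<Rightarrow> real) \<Rightarrow> ('m \<Rightarrow> 'm tvec \<Rightarrow> 'm tvec \<Rightarrow> real) \<Rightarrow> bool"
where
  "almost_contact_metric A \<phi> \<xi> \<eta> g \<longleftrightarrow>
     tensor_field_1_1 A \<phi> \<and> \<xi> \<in> vector_fields A \<and> one_form A \<eta> \<and>
     (\<forall>p. \<phi> p (\<xi> p) = 0) \<and>
     (\<forall>p. \<forall>v\<in>tangent_space A p. \<eta> p (\<phi> p v) = 0) \<and>
     (\<forall>p. \<eta> p (\<xi> p) = 1) \<and>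
     (\<forall>p. \<forall>v\<in>tangent_space A p. \<phi> p (\<phi> p v) = - v + \<eta> p v *\<^sub>R \<xi> p) \<and>
     (\<forall>p. \<forall>v\<in>tangent_space A p. \<forall>w\<in>tangent_space A p.
        g p (\<phi> p v) (\<phi> p w) = g p v w - \<eta> p v * \<eta> p w)"

definition almost_contact_metric_manifold ::
  "('m::{t2_space, second_countable_topology}, 'e::euclidean_space) chart set \<Rightarrow>
   ('m \<Rightarrow> 'm tvec \<Rightarrow> 'm tvec) \<Rightarrow> 'm vfield \<Rightarrow> ('m \<Rightarrow> 'm tvec \<Rightarrow> real) \<Rightarrow>
   ('m \<Rightarrow> 'm tvec \<Rightarrow> 'm tvec \<Rightarrow> real) \<Rightarrow> bool"
where
  "almost_contact_metric_manifold A \<phi> \<xi> \<eta> g \<longleftrightarrow>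
     riemannian_manifold A g \<and> almost_contact_metric A \<phi> \<xi> \<eta> g"

text \<open>\<open>D\<close> is the Levi-Civita connection, and
  \<open>D X (apply_endo \<phi> Y) - apply_endo \<phi> (D X Y)\<close> is $(\nabla_X\phi)Y$. The signs are those obtained
  from the more common convention by replacing \<open>\<phi>\<close> with \<open>- \<phi>\<close>.\<close>

definition sasakian_manifold ::
  "('m::{t2_space, second_countable_topology}, 'e::euclidean_space) chart set \<Rightarrow>
   ('m \<Rightarrow> 'm tvec \<Rightarrow> 'm tvec) \<Rightarrow> 'm vfield \<Rightarrow> ('m \<Rightarrow> 'm tvec \<Rightarrow> real) \<Rightarrow>
   ('m \<Rightarrow> 'm tvec \<Rightarrow> 'm tvec \<Rightarrow> real) \<Rightarrow> ('m vfield \<Rightarrow> 'm vfield \<Rightarrow> 'm vfield) \<Rightarrow> bool"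
where
  "sasakian_manifold A \<phi> \<xi> \<eta> g D \<longleftrightarrow>
     almost_contact_metric_manifold A \<phi> \<xi> \<eta> g \<and> levi_civita A g D \<and>
     (\<forall>X\<in>vector_fields A. \<forall>Y\<in>vector_fields A.
        D X (apply_endo \<phi> Y) - apply_endo \<phi> (D X Y) =
          (\<lambda>p. - (g p (X p) (Y p) *\<^sub>R \<xi> p) + \<eta> p (Y p) *\<^sub>R X p)) \<and>
     (\<forall>X\<in>vector_fields A. D X \<xi> = apply_endo \<phi> X)"


section \<open>Submersions\<close>

definition pushforward ::
  "('n, 'b::euclidean_space) chart set \<Rightarrow> ('m \<Rightarrow> 'n) \<Rightarrow> 'm tvec \<Rightarrow> 'n tvec"
  where "pushforward B F v = (\<lambda>f. if smooth_fun B f then v (f \<circ> F) else 0)"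

definition submersion ::
  "('m::topological_space, 'a::euclidean_space) chart set \<Rightarrow>
   ('n::topological_space, 'b::euclidean_space) chart set \<Rightarrow> ('m \<Rightarrow> 'n) \<Rightarrow> bool"
where
  "submersion A B F \<longleftrightarrow> smooth_map A B F \<and>
     (\<forall>p. pushforward B F ` tangent_space A p = tangent_space B (F p))"

definition vertical ::
  "('m, 'a::euclidean_space) chart set \<Rightarrow> ('n, 'b::euclidean_space) chart set \<Rightarrow>
   ('m \<Rightarrow> 'n) \<Rightarrow> 'm \<Rightarrow> 'm tvec set"
  where "vertical A B F p = {v \<in> tangent_space A p. pushforward B F v = 0}"

definition orth_complement ::
  "('m, 'a::euclidean_space) chart set \<Rightarrow> ('m \<Rightarrow> 'm tvec \<Rightarrow> 'm tvec \<Rightarrow> real) \<Rightarrow>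
   ('m \<Rightarrow> 'm tvec set) \<Rightarrow> 'm \<Rightarrow> 'm tvec set"
  where "orth_complement A g S p = {w \<in> tangent_space A p. \<forall>v\<in>S p. g p w v = 0}"

abbreviation horizontal ::
  "('m, 'a::euclidean_space) chart set \<Rightarrow> ('m \<Rightarrow> 'm tvec \<Rightarrow> 'm tvec \<Rightarrow> real) \<Rightarrow>
   ('n, 'b::euclidean_space) chart set \<Rightarrow> ('m \<Rightarrow> 'n) \<Rightarrow> 'm \<Rightarrow> 'm tvec set"
  where "horizontal A g B F \<equiv> orth_complement A g (vertical A B F)"

definition vert_proj ::
  "('m, 'a::euclidean_space) chart set \<Rightarrow> ('m \<Rightarrow> 'm tvec \<Rightarrow> 'm tvec \<Rightarrow> real) \<Rightarrow>
   ('n, 'b::euclidean_space) chart set \<Rightarrow> ('m \<Rightarrow> 'n) \<Rightarrow> 'm vfield \<Rightarrow> 'm vfield"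
where
  "vert_proj A g B F E = (\<lambda>p. THE v. v \<in> vertical A B F p \<and> E p - v \<in> horizontal A g B F p)"

definition hor_proj ::
  "('m, 'a::euclidean_space) chart set \<Rightarrow> ('m \<Rightarrow> 'm tvec \<Rightarrow> 'm tvec \<Rightarrow> real) \<Rightarrow>
   ('n, 'b::euclidean_space) chart set \<Rightarrow> ('m \<Rightarrow> 'n) \<Rightarrow> 'm vfield \<Rightarrow> 'm vfield"
where
  "hor_proj A g B F E = (\<lambda>p. THE w. w \<in> horizontal A g B F p \<and> E p - w \<in> vertical A B F p)"

definition horizontally_conformal_submersion ::
  "('m::topological_space, 'a::euclidean_space) chart set \<Rightarrow>
   ('m \<Rightarrow> 'm tvec \<Rightarrow> 'm tvec \<Rightarrow> real) \<Rightarrow>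
   ('n::topological_space, 'b::euclidean_space) chart set \<Rightarrow>
   ('n \<Rightarrow> 'n tvec \<Rightarrow> 'n tvec \<Rightarrow> real) \<Rightarrow> ('m \<Rightarrow> 'n) \<Rightarrow> ('m \<Rightarrow> real) \<Rightarrow> bool"
where
  "horizontally_conformal_submersion A g B h F dil \<longleftrightarrow>
     submersion A B F \<and> smooth_fun A dil \<and> (\<forall>p. dil p > 0) \<and>
     (\<forall>X\<in>sections_of A (horizontal A g B F). \<forall>Y\<in>sections_of A (horizontal A g B F). \<forall>p.
        (dil p)\<^sup>2 * g p (X p) (Y p) = h (F p) (pushforward B F (X p)) (pushforward B F (Y p)))"

definition horizontally_homothetic ::
  "('m, 'a::euclidean_space) chart set \<Rightarrow> ('m \<Rightarrow> 'm tvec \<Rightarrow> 'm tvec \<Rightarrow> real) \<Rightarrow>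
   ('n, 'b::euclidean_space) chart set \<Rightarrow> ('m \<Rightarrow> 'n) \<Rightarrow> ('m \<Rightarrow> real) \<Rightarrow> bool"
where
  "horizontally_homothetic A g B F dil \<longleftrightarrow> hor_proj A g B F (gradient A g dil) = 0"

definition conformal_anti_invariant_xi_perp_submersion ::
  "('m::{t2_space, second_countable_topology}, 'a::euclidean_space) chart set \<Rightarrow>
   ('m \<Rightarrow> 'm tvec \<Rightarrow> 'm tvec) \<Rightarrow> 'm vfield \<Rightarrow> ('m \<Rightarrow> 'm tvec \<Rightarrow> real) \<Rightarrow>
   ('m \<Rightarrow> 'm tvec \<Rightarrow> 'm tvec \<Rightarrow> real) \<Rightarrow>
   ('n::{t2_space, second_countable_topology}, 'b::euclidean_space) chart set \<Rightarrow>
   ('n \<Rightarrow> 'n tvec \<Rightarrow> 'n tvec \<Rightarrow> real) \<Rightarrow> ('m \<Rightarrow> 'n) \<Rightarrow> ('m \<Rightarrow> real) \<Rightarrow> bool"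
where
  "conformal_anti_invariant_xi_perp_submersion A \<phi> \<xi> \<eta> g B h F dil \<longleftrightarrow>
     almost_contact_metric_manifold A \<phi> \<xi> \<eta> g \<and> riemannian_manifold B h \<and>
     horizontally_conformal_submersion A g B h F dil \<and>
     (\<forall>p. \<xi> p \<in> horizontal A g B F p) \<and>
     (\<forall>p. \<phi> p ` vertical A B F p \<subseteq> horizontal A g B F p)"


section \<open>O'Neill tensors\<close>

definition oneill_A ::
  "('m, 'a::euclidean_space) chart set \<Rightarrow> ('m \<Rightarrow> 'm tvec \<Rightarrow> 'm tvec \<Rightarrow> real) \<Rightarrow>
   ('n, 'b::euclidean_space) chart set \<Rightarrow> ('m \<Rightarrow> 'n) \<Rightarrow>
   ('m vfield \<Rightarrow> 'm vfield \<Rightarrow> 'm vfield) \<Rightarrow> 'm vfield \<Rightarrow> 'm vfield \<Rightarrow> 'm vfield"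
where
  "oneill_A A g B F D X Y =
     vert_proj A g B F (D (hor_proj A g B F X) (hor_proj A g B F Y)) +
     hor_proj A g B F (D (hor_proj A g B F X) (vert_proj A g B F Y))"

definition oneill_T ::
  "('m, 'a::euclidean_space) chart set \<Rightarrow> ('m \<Rightarrow> 'm tvec \<Rightarrow> 'm tvec \<Rightarrow> real) \<Rightarrow>
   ('n, 'b::euclidean_space) chart set \<Rightarrow> ('m \<Rightarrow> 'n) \<Rightarrow>
   ('m vfield \<Rightarrow> 'm vfield \<Rightarrow> 'm vfield) \<Rightarrow> 'm vfield \<Rightarrow> 'm vfield \<Rightarrow> 'm vfield"
where
  "oneill_T A g B F D X Y =
     hor_proj A g B F (D (vert_proj A g B F X) (vert_proj A g B F Y)) +
     vert_proj A g B F (D (vert_proj A g B F X) (hor_proj A g B F Y))"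


section \<open>The pullback connection and the second fundamental form\<close>

text \<open>Smooth sections of the pullback bundle $F^{-1}TN$.\<close>

definition fields_along ::
  "('m, 'a::euclidean_space) chart set \<Rightarrow> ('n, 'b::euclidean_space) chart set \<Rightarrow>
   ('m \<Rightarrow> 'n) \<Rightarrow> ('m \<Rightarrow> 'n tvec) set"
where
  "fields_along A B F = {W. (\<forall>p. W p \<in> tangent_space B (F p)) \<and>
     (\<forall>f. smooth_fun B f \<longrightarrow> smooth_fun A (\<lambda>p. W p f))}"

text \<open>The pullback of the connection \<open>DN\<close> along \<open>F\<close> is the connection on $F^{-1}TN$ with
  $\nabla^F_X (Y \circ F) = \nabla_{F_*X} Y$. As \<open>DN Z Y\<close> at a point depends on \<open>Z\<close> only through its
  value there, the right-hand side at \<open>p\<close> is computed with any field \<open>Z\<close> whose value at \<open>F p\<close>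
  is the pushforward of \<open>X p\<close>.\<close>

definition pullback_connection ::
  "('m, 'a::euclidean_space) chart set \<Rightarrow> ('n, 'b::euclidean_space) chart set \<Rightarrow> ('m \<Rightarrow> 'n) \<Rightarrow>
   ('n vfield \<Rightarrow> 'n vfield \<Rightarrow> 'n vfield) \<Rightarrow>
   ('m vfield \<Rightarrow> ('m \<Rightarrow> 'n tvec) \<Rightarrow> ('m \<Rightarrow> 'n tvec)) \<Rightarrow> bool"
where
  "pullback_connection A B F DN DF \<longleftrightarrow>
     (\<forall>X\<in>vector_fields A. \<forall>W\<in>fields_along A B F. DF X W \<in> fields_along A B F) \<and>
     (\<forall>X\<in>vector_fields A. \<forall>X'\<in>vector_fields A. \<forall>W\<in>fields_along A B F.
        DF (X + X') W = DF X W + DF X' W) \<and>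
     (\<forall>f. \<forall>X\<in>vector_fields A. \<forall>W\<in>fields_along A B F. smooth_fun A f \<longrightarrow>
        DF (\<lambda>p. f p *\<^sub>R X p) W = (\<lambda>p. f p *\<^sub>R DF X W p)) \<and>
     (\<forall>X\<in>vector_fields A. \<forall>W\<in>fields_along A B F. \<forall>W'\<in>fields_along A B F.
        DF X (W + W') = DF X W + DF X W') \<and>
     (\<forall>f. \<forall>X\<in>vector_fields A. \<forall>W\<in>fields_along A B F. smooth_fun A f \<longrightarrow>
        DF X (\<lambda>p. f p *\<^sub>R W p) = (\<lambda>p. X p f *\<^sub>R W p + f p *\<^sub>R DF X W p)) \<and>
     (\<forall>X\<in>vector_fields A. \<forall>Y\<in>vector_fields B. \<forall>p. \<forall>Z\<in>vector_fields B.
        Z (F p) = pushforward B F (X p) \<longrightarrow> DF X (Y \<circ> F) p = DN Z Y (F p))"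

definition second_fundamental_form ::
  "('n, 'b::euclidean_space) chart set \<Rightarrow> ('m \<Rightarrow> 'n) \<Rightarrow>
   ('m vfield \<Rightarrow> 'm vfield \<Rightarrow> 'm vfield) \<Rightarrow>
   ('m vfield \<Rightarrow> ('m \<Rightarrow> 'n tvec) \<Rightarrow> ('m \<Rightarrow> 'n tvec)) \<Rightarrow>
   'm vfield \<Rightarrow> 'm vfield \<Rightarrow> ('m \<Rightarrow> 'n tvec)"
where
  "second_fundamental_form B F DM DF X Y =
     (\<lambda>p. DF X (\<lambda>q. pushforward B F (Y q)) p - pushforward B F (DM X Y p))"

definition totally_geodesic ::
  "('m, 'a::euclidean_space) chart set \<Rightarrow> ('n, 'b::euclidean_space) chart set \<Rightarrow> ('m \<Rightarrow> 'n) \<Rightarrow>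
   ('m vfield \<Rightarrow> 'm vfield \<Rightarrow> 'm vfield) \<Rightarrow>
   ('m vfield \<Rightarrow> ('m \<Rightarrow> 'n tvec) \<Rightarrow> ('m \<Rightarrow> 'n tvec)) \<Rightarrow> bool"
where
  "totally_geodesic A B F DM DF \<longleftrightarrow>
     (\<forall>X\<in>vector_fields A. \<forall>Y\<in>vector_fields A. second_fundamental_form B F DM DF X Y = 0)"

end

theory Submission
  imports Defs
begin

text \<open>Either side of the equivalence forces \<open>\<pi>\<close> to have no vertical vectors, and for such a map only
  the condition on the dilation is left.

  Let \<open>V\<close> be a vertical field. Since \<open>\<xi>\<close> is horizontal, \<open>\<nabla>\<^sub>X \<xi> = \<phi> X\<close> gives
  \<open>g(\<nabla>\<^sub>X Y, \<xi>) = - g(Y, \<phi> X)\<close> for every \<open>Y\<close> orthogonal to \<open>\<xi>\<close>. If \<open>\<pi>\<close> is totally geodesic, then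
  \<open>\<nabla>\<^sub>X V\<close> is vertical for all \<open>X\<close>, hence orthogonal to \<open>\<xi>\<close>; with \<open>X = \<phi> V\<close> this reads
  \<open>0 = - g(V, \<phi>\<^sup>2 V) = g(V, V)\<close> (\<open>totally_geodesic_no_vertical\<close>). If instead the horizontal part of
  \<open>\<nabla>\<^sub>V \<phi> V\<close> lies in \<open>\<phi> (ker \<pi>\<^sub>*)\<close>, which is orthogonal to \<open>\<xi>\<close>, then
  \<open>0 = g(\<nabla>\<^sub>V \<phi> V, \<xi>) = - g(\<phi> V, \<phi> V) = - g(V, V)\<close> (\<open>hor_image_no_vertical\<close>). So in both cases all
  vertical fields vanish, and as every vertical vector extends to a vertical field
  (\<open>extend_vertical_vector\<close>), \<open>ker \<pi>\<^sub>* = 0\<close>. Conditions (a) and (c) then speak about the zero field only.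

  When \<open>ker \<pi>\<^sub>* = 0\<close>, all fields are horizontal and \<open>\<lambda>\<^sup>2 g\<^sub>M\<close> is the pullback of \<open>g\<^sub>N\<close>. Let
  \<open>S\<close> be the second fundamental form of \<open>\<pi>\<close>. The pullback connection inherits from the Levi-Civita
  connection of \<open>N\<close> that it is torsion free and metric (\<open>DF_torsion_free\<close>, \<open>DF_metric\<close>), so \<open>S\<close> is
  symmetric and
  \<open>g\<^sub>N(S(X,Y), \<pi>\<^sub>*Z) + g\<^sub>N(\<pi>\<^sub>*Y, S(X,Z)) = X(\<lambda>\<^sup>2) g\<^sub>M(Y,Z)\<close>. If \<open>S = 0\<close>, the choice \<open>Y = Z = X\<close> gives
  \<open>d\<lambda> = 0\<close>. If \<open>d\<lambda> = 0\<close>, the trilinear form \<open>g\<^sub>N(S(X,Y), \<pi>\<^sub>*Z)\<close> is symmetric in the first two arguments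
  and skew in the last two, so it vanishes. This is \<open>totally_geodesic_iff_homothetic\<close>.

  Tangent vectors are derivations of the algebra of globally defined smooth functions, so the link between
  them and coordinates has to be made. It is made once, in \<open>frame_exists\<close>: near any point there are
  smooth functions \<open>f\<^sub>i\<close> and vector fields \<open>E\<^sub>i\<close>, all defined on the whole manifold, such that
  \<open>\<rho> w = \<Sum> w(f\<^sub>i) E\<^sub>i\<close> for every tangent vector \<open>w\<close>, with a cutoff function \<open>\<rho>\<close>. This uses
  bump functions and the Hadamard lemma. Finite dimension of tangent spaces, extension of vectors to fields,
  and locality of connections are all read off from this one global identity.\<close>

section \<open>Calculus of smooth functions on open sets\<close>

lemma Ck_on_subset: "Ck_on k f S \<Longrightarrow> T \<subseteq> S \<Longrightarrow> Ck_on k f T"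
  by (induction k arbitrary: f) (auto intro: continuous_on_subset)

lemma Ck_on_cong:
  assumes "open S" "\<And>x. x \<in> S \<Longrightarrow> f x = g x" "Ck_on k f S"
  shows "Ck_on k g S"
  using assms
proof (induction k arbitrary: f g)
  case 0
  then show ?case by (auto cong: continuous_on_cong_simp)
next
  case (Suc k)
  have d: "f differentiable at x" if "x \<in> S" for x using Suc.prems(3) that by simp
  have "g differentiable at x" if "x \<in> S" for x
    using d[OF that] Suc.prems(1,2) that
    by (meson differentiable_def has_derivative_transform_within_open)
  moreover have "Ck_on k (\<lambda>x. frechet_derivative g (at x) v) S" for v
    by (rule Suc.IH[where f="\<lambda>x. frechet_derivative f (at x) v"])
      (use Suc.prems d in \<open>auto simp: frechet_derivative_transform_within_open[OF d]\<close>)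
  ultimately show ?case by simp
qed

lemma Ck_on_SucI:
  assumes "open S" "\<And>x. x \<in> S \<Longrightarrow> (f has_derivative f' x) (at x)"
    and "\<And>v. Ck_on k (\<lambda>x. f' x v) S"
  shows "Ck_on (Suc k) f S"
proof -
  have "Ck_on k (\<lambda>x. frechet_derivative f (at x) v) S" for v
    by (rule Ck_on_cong[OF assms(1) _ assms(3)]) (simp add: frechet_derivative_at[OF assms(2), symmetric])
  then show ?thesis using assms(2) by (auto simp: differentiable_def)
qed

lemma Ck_on_SucD: "Ck_on (Suc k) f S \<Longrightarrow> Ck_on k f S"
proof (induction k arbitrary: f)
  case 0
  then show ?case
    by (auto intro!: continuous_at_imp_continuous_on differentiable_imp_continuous_within)
next
  case (Suc k)
  show ?case unfolding Ck_on.simps(2)[of k]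
  proof (intro conjI allI ballI)
    fix x assume "x \<in> S" with Suc.prems show "f differentiable at x" by simp
  next
    fix v
    have "Ck_on (Suc k) (\<lambda>x. frechet_derivative f (at x) v) S"
      using Suc.prems unfolding Ck_on.simps(2)[of "Suc k"] by blast
    then show "Ck_on k (\<lambda>x. frechet_derivative f (at x) v) S" by (rule Suc.IH)
  qed
qed

lemma Ck_on_imp_continuous_on: "Ck_on k f S \<Longrightarrow> continuous_on S f"
  by (induction k) (auto dest: Ck_on_SucD simp del: Ck_on.simps(2))

lemma Ck_on_derivative:
  assumes "Ck_on (Suc k) f S" "x \<in> S"
  shows "(f has_derivative frechet_derivative f (at x)) (at x)"
  using assms by (simp add: frechet_derivative_works)

lemma Ck_on_locally:
  assumes "\<And>x. x \<in> S \<Longrightarrow> \<exists>T. open T \<and> x \<in> T \<and> Ck_on k f T"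
  shows "Ck_on k f S"
  using assms
proof (induction k arbitrary: f)
  case 0
  show ?case unfolding Ck_on.simps
  proof (rule continuous_at_imp_continuous_on, rule)
    fix x assume "x \<in> S"
    with 0 obtain T where "open T" "x \<in> T" "continuous_on T f" by auto
    then show "isCont f x" by (simp add: continuous_on_eq_continuous_at)
  qed
next
  case (Suc k)
  have "f differentiable at x" if "x \<in> S" for x using Suc.prems[OF that] by auto
  moreover have "Ck_on k (\<lambda>x. frechet_derivative f (at x) v) S" for v
  proof (rule Suc.IH)
    fix x assume "x \<in> S"
    then obtain T where "open T" "x \<in> T" "Ck_on (Suc k) f T" using Suc.prems by blast
    then show "\<exists>T. open T \<and> x \<in> T \<and> Ck_on k (\<lambda>x. frechet_derivative f (at x) v) T" by auto
  qed
  ultimately show ?case by simp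
qed

lemma Ck_on_const: "open S \<Longrightarrow> Ck_on k (\<lambda>x. c) S"
  by (induction k arbitrary: c) (auto intro!: Ck_on_SucI[where f'="\<lambda>_ _. 0"] derivative_eq_intros)

lemma Ck_on_bounded_linear:
  assumes "open S" "bounded_linear L" "Ck_on k f S"
  shows "Ck_on k (\<lambda>x. L (f x)) S"
  using assms(3)
proof (induction k arbitrary: f)
  case 0
  then show ?case using bounded_linear.continuous_on[OF assms(2)] by simp
next
  case (Suc k)
  show ?case
    by (rule Ck_on_SucI[OF assms(1) bounded_linear.has_derivative[OF assms(2) Ck_on_derivative[OF Suc.prems]]])
      (use Suc in auto)
qed

lemma Ck_on_id: "open S \<Longrightarrow> Ck_on k (\<lambda>x. x) S"
  by (cases k) (auto intro!: Ck_on_SucI[where f'="\<lambda>_ v. v"] Ck_on_const derivative_eq_intros)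

lemma Ck_on_add:
  assumes "open S" "Ck_on k f S" "Ck_on k g S"
  shows "Ck_on k (\<lambda>x. f x + g x) S"
  using assms(2,3)
proof (induction k arbitrary: f g)
  case 0
  then show ?case by (auto intro: continuous_intros)
next
  case (Suc k)
  show ?case
    by (rule Ck_on_SucI[OF assms(1) has_derivative_add[OF Ck_on_derivative[OF Suc.prems(1)]
            Ck_on_derivative[OF Suc.prems(2)]]])
      (use Suc in auto)
qed

lemma Ck_on_bilinear:
  assumes "open S" "bounded_bilinear b" "Ck_on k f S" "Ck_on k g S"
  shows "Ck_on k (\<lambda>x. b (f x) (g x)) S"
  using assms(3,4)
proof (induction k arbitrary: f g)
  case 0
  then show ?case using bounded_bilinear.continuous_on[OF assms(2)] by simp
next
  case (Suc k)
  show ?case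
    by (rule Ck_on_SucI[OF assms(1) bounded_bilinear.FDERIV[OF assms(2) Ck_on_derivative[OF Suc.prems(1)]
            Ck_on_derivative[OF Suc.prems(2)]]])
      (use Suc Suc.prems[THEN Ck_on_SucD] in \<open>auto intro!: Ck_on_add[OF assms(1)]\<close>)
qed

lemmas Ck_on_mult = Ck_on_bilinear[OF _ bounded_bilinear_mult]
lemmas Ck_on_scaleR = Ck_on_bilinear[OF _ bounded_bilinear_scaleR]

lemma Ck_on_sum:
  assumes "open S" "\<And>i. i \<in> I \<Longrightarrow> Ck_on k (f i) S"
  shows "Ck_on k (\<lambda>x. \<Sum>i\<in>I. f i x) S"
  using assms(2) by (induction I rule: infinite_finite_induct) (auto intro: Ck_on_const Ck_on_add assms(1))

text \<open>The derivative of \<open>f \<circ> g\<close> in direction \<open>v\<close> is expanded in coordinates of the middle space,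
  because the induction hypothesis is about derivatives of \<open>f\<close> in a fixed direction, while the chain rule
  produces the direction \<open>Dg(x) v\<close>, which moves with \<open>x\<close>.\<close>

lemma Ck_on_compose:
  fixes g :: "'a::real_normed_vector \<Rightarrow> 'b::euclidean_space"
  assumes "open S" "Ck_on k f T" "Ck_on k g S" "g ` S \<subseteq> T"
  shows "Ck_on k (\<lambda>x. f (g x)) S"
  using assms(2,3)
proof (induction k arbitrary: f)
  case 0
  then show ?case using assms(4) continuous_on_compose2 by auto
next
  case (Suc k)
  let ?f' = "\<lambda>x. frechet_derivative f (at x)" and ?g' = "\<lambda>x. frechet_derivative g (at x)"
  have f: "(f has_derivative ?f' (g x)) (at (g x))" if "x \<in> S" for x
    using Ck_on_derivative[OF Suc.prems(1)] that assms(4) by blast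
  have g: "(g has_derivative ?g' x) (at x)" if "x \<in> S" for x
    using Ck_on_derivative[OF Suc.prems(2)] that by blast
  have D: "((\<lambda>x. f (g x)) has_derivative (\<lambda>v. \<Sum>i\<in>Basis. (?g' x v \<bullet> i) *\<^sub>R ?f' (g x) i)) (at x)"
    if "x \<in> S" for x
  proof -
    have lin: "linear (?f' (g x))" using f[OF that] has_derivative_linear by blast
    have rep: "?f' (g x) w = (\<Sum>i\<in>Basis. (w \<bullet> i) *\<^sub>R ?f' (g x) i)" for w
    proof -
      have "?f' (g x) w = ?f' (g x) (\<Sum>i\<in>Basis. (w \<bullet> i) *\<^sub>R i)"
        by (simp add: euclidean_representation)
      then show ?thesis by (simp add: linear_sum[OF lin] linear_scale[OF lin])
    qed
    have "(\<lambda>v. ?f' (g x) (?g' x v)) = (\<lambda>v. \<Sum>i\<in>Basis. (?g' x v \<bullet> i) *\<^sub>R ?f' (g x) i)"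
      by (rule ext) (rule rep)
    then show ?thesis
      using has_derivative_compose[OF g[OF that] f[OF that]] by (simp only:)
  qed
  show ?case
  proof (rule Ck_on_SucI[OF assms(1) D])
    fix v
    show "Ck_on k (\<lambda>x. \<Sum>i\<in>Basis. (?g' x v \<bullet> i) *\<^sub>R ?f' (g x) i) S"
    proof (rule Ck_on_sum[OF assms(1)], rule Ck_on_scaleR[OF assms(1)])
      fix i :: 'b
      have "Ck_on k (\<lambda>x. ?g' x v) S" using Suc.prems(2) by simp
      then show "Ck_on k (\<lambda>x. ?g' x v \<bullet> i) S"
        by (rule Ck_on_bounded_linear[OF assms(1) bounded_linear_inner_left])
      have "Ck_on k (\<lambda>y. ?f' y i) T" using Suc.prems(1) by simp
      then show "Ck_on k (\<lambda>x. ?f' (g x) i) S"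
        using Suc.IH[of "\<lambda>y. ?f' y i"] Ck_on_SucD[OF Suc.prems(2)] by simp
    qed
  qed
qed

lemma Ck_on_inverse:
  fixes S :: "real set"
  assumes "open S" "0 \<notin> S"
  shows "Ck_on k inverse S"
proof (induction k)
  case 0
  have "x \<noteq> 0" if "x \<in> S" for x using that assms(2) by metis
  then show ?case using continuous_on_inverse[OF continuous_on_id, of S] by (simp add: id_def)
next
  case (Suc k)
  show ?case
  proof (rule Ck_on_SucI[OF assms(1)])
    fix x assume "x \<in> S"
    then have "x \<noteq> 0" using assms(2) by metis
    then show "(inverse has_derivative (\<lambda>v. (- v) * (inverse x * inverse x))) (at x)"
      using has_derivative_inverse'[of x UNIV] by (simp add: mult_ac)
  next
    fix v :: real
    show "Ck_on k (\<lambda>x. (- v) * (inverse x * inverse x)) S"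
      by (intro Ck_on_mult Ck_on_const assms(1) Suc)
  qed
qed

lemma smooth_onD: "smooth_on S f \<Longrightarrow> Ck_on k f S"
  by (simp add: smooth_on_def)

lemma smooth_on_subset: "smooth_on S f \<Longrightarrow> T \<subseteq> S \<Longrightarrow> smooth_on T f"
  by (meson Ck_on_subset smooth_on_def)

lemma smooth_on_cong: "open S \<Longrightarrow> (\<And>x. x \<in> S \<Longrightarrow> f x = g x) \<Longrightarrow> smooth_on S f \<Longrightarrow> smooth_on S g"
  unfolding smooth_on_def using Ck_on_cong by blast

lemma smooth_on_locally:
  assumes "\<And>x. x \<in> S \<Longrightarrow> \<exists>T. open T \<and> x \<in> T \<and> smooth_on T f"
  shows "smooth_on S f"
  unfolding smooth_on_def
proof
  fix k show "Ck_on k f S"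
    by (rule Ck_on_locally) (use assms in \<open>auto simp: smooth_on_def\<close>)
qed

lemma smooth_on_imp_has_derivative:
  "smooth_on S f \<Longrightarrow> x \<in> S \<Longrightarrow> (f has_derivative frechet_derivative f (at x)) (at x)"
  by (rule Ck_on_derivative[OF smooth_onD[where k="Suc 0"]])

lemma smooth_on_frechet_derivative:
  "smooth_on S f \<Longrightarrow> smooth_on S (\<lambda>x. frechet_derivative f (at x) v)"
  unfolding smooth_on_def using Ck_on.simps(2) by blast

lemma smooth_on_imp_continuous_on: "smooth_on S f \<Longrightarrow> continuous_on S f"
  using smooth_onD[of S f 0] by simp

named_theorems smooth_intros

lemma smooth_on_const [smooth_intros]: "open S \<Longrightarrow> smooth_on S (\<lambda>x. c)"
  by (simp add: smooth_on_def Ck_on_const)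

lemma smooth_on_id [smooth_intros]: "open S \<Longrightarrow> smooth_on S (\<lambda>x. x)"
  by (simp add: smooth_on_def Ck_on_id)

lemma smooth_on_add [smooth_intros]:
  "open S \<Longrightarrow> smooth_on S f \<Longrightarrow> smooth_on S g \<Longrightarrow> smooth_on S (\<lambda>x. f x + g x)"
  by (simp add: smooth_on_def Ck_on_add)

lemma smooth_on_inner [smooth_intros]:
  "open S \<Longrightarrow> smooth_on S f \<Longrightarrow> smooth_on S g \<Longrightarrow> smooth_on S (\<lambda>x. f x \<bullet> g x)"
  by (simp add: smooth_on_def Ck_on_bilinear[OF _ bounded_bilinear_inner])

lemma smooth_on_mult [smooth_intros]:
  fixes f g :: "'a::real_normed_vector \<Rightarrow> real"
  shows "open S \<Longrightarrow> smooth_on S f \<Longrightarrow> smooth_on S g \<Longrightarrow> smooth_on S (\<lambda>x. f x * g x)"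
  by (simp add: smooth_on_def Ck_on_mult)

lemma smooth_on_diff [smooth_intros]:
  assumes "open S" "smooth_on S f" "smooth_on S g"
  shows "smooth_on S (\<lambda>x. f x - g x)"
  using smooth_on_add[OF assms(1,2), of "\<lambda>x. - g x"] assms
    Ck_on_bounded_linear[OF assms(1) bounded_linear_minus[OF bounded_linear_ident], of _ g]
  by (simp add: smooth_on_def)

lemma smooth_on_compose:
  fixes g :: "'a::real_normed_vector \<Rightarrow> 'b::euclidean_space"
  assumes "open S" "smooth_on T f" "smooth_on S g" "g ` S \<subseteq> T"
  shows "smooth_on S (\<lambda>x. f (g x))"
  using assms Ck_on_compose unfolding smooth_on_def by blast

lemma smooth_on_divide:
  fixes f g :: "'a::real_normed_vector \<Rightarrow> real"
  assumes "open S" "smooth_on S f" "smooth_on S g" "\<And>x. x \<in> S \<Longrightarrow> g x \<noteq> 0"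
  shows "smooth_on S (\<lambda>x. f x / g x)"
proof -
  have "smooth_on (- {0::real}) inverse"
    unfolding smooth_on_def by (intro allI Ck_on_inverse) auto
  then have "smooth_on S (\<lambda>x. inverse (g x))"
    by (rule smooth_on_compose[OF assms(1)]) (use assms in auto)
  then show ?thesis
    using smooth_on_mult[OF assms(1,2)] by (simp add: divide_inverse)
qed

section \<open>Bump functions\<close>

text \<open>The family of functions \<open>t\<^sup>-\<^sup>m exp(-1/t)\<close>, extended by zero, is closed under
  differentiation up to linear combinations; this makes the smoothness of \<open>exp(-1/t)\<close> at \<open>0\<close> an
  induction over all \<open>m\<close> at once.\<close>

definition flat_exp :: "nat \<Rightarrow> real \<Rightarrow> real"
  where "flat_exp m t = (if t > 0 then inverse t ^ m * exp (- inverse t) else 0)"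

lemma flat_exp_tendsto_0: "flat_exp m \<midarrow>0\<rightarrow> 0"
proof -
  have "((\<lambda>t. inverse t ^ m * exp (- inverse t)) \<longlongrightarrow> 0) (at_right (0::real))"
    using filterlim_compose[OF tendsto_power_div_exp_0[of m] filterlim_inverse_at_top_right]
    by (simp add: exp_minus divide_inverse)
  then have "(flat_exp m \<longlongrightarrow> 0) (at_right 0)"
    by (rule Lim_transform_eventually)
      (auto simp: flat_exp_def eventually_at_filter)
  moreover have "(flat_exp m \<longlongrightarrow> 0) (at_left 0)"
    by (rule Lim_transform_eventually[OF tendsto_const])
      (auto simp: flat_exp_def eventually_at_filter)
  ultimately show ?thesis
    by (simp add: filterlim_split_at)
qed

lemma flat_exp_has_derivative:
  "(flat_exp m has_real_derivative (flat_exp (m + 2) t - real m * flat_exp (m + 1) t)) (at t)"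
proof -
  consider "t > 0" | "t < 0" | "t = 0" by linarith
  then show ?thesis
  proof cases
    case 1
    have pow: "((\<lambda>t. inverse t ^ m) has_real_derivative - real m * inverse t ^ (m + 1)) (at t)"
    proof (cases m)
      case (Suc n)
      show ?thesis
        unfolding Suc
        by (rule DERIV_cong[OF DERIV_power_Suc[OF DERIV_inverse]]) (use 1 in \<open>auto simp: field_simps\<close>)
    qed simp
    have ex: "((\<lambda>t. exp (- inverse t)) has_real_derivative inverse t ^ 2 * exp (- inverse t)) (at t)"
      using 1 by (auto intro!: derivative_eq_intros simp: field_simps power2_eq_square)
    have "((\<lambda>t. inverse t ^ m * exp (- inverse t)) has_real_derivative
        (flat_exp (m + 2) t - real m * flat_exp (m + 1) t)) (at t)"
      using DERIV_mult[OF pow ex] 1 by (simp add: flat_exp_def power_add power2_eq_square mult_ac)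
    then show ?thesis
      by (rule has_field_derivative_transform_within_open[where S="{0<..}"])
        (use 1 in \<open>auto simp: flat_exp_def\<close>)
  next
    case 2
    have "((\<lambda>t. 0) has_real_derivative (flat_exp (m + 2) t - real m * flat_exp (m + 1) t)) (at t)"
      using 2 by (auto simp: flat_exp_def)
    then show ?thesis
      by (rule has_field_derivative_transform_within_open[where S="{..<0}"])
        (use 2 in \<open>auto simp: flat_exp_def\<close>)
  next
    case 3
    have "(\<lambda>h. (flat_exp m (0 + h) - flat_exp m 0) / h) = flat_exp (Suc m)"
      by (auto simp: flat_exp_def fun_eq_iff field_simps)
    then show ?thesis
      using flat_exp_tendsto_0[of "Suc m"] 3 by (simp add: DERIV_def flat_exp_def)
  qed
qed

lemma smooth_on_flat_exp: "smooth_on UNIV (flat_exp m)"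
  unfolding smooth_on_def
proof
  fix k show "Ck_on k (flat_exp m) UNIV"
  proof (induction k arbitrary: m)
    case 0
    show ?case
      using DERIV_isCont[OF flat_exp_has_derivative] by (auto intro: continuous_at_imp_continuous_on)
  next
    case (Suc k)
    have 2: "Ck_on k (\<lambda>x. (flat_exp (m + 2) x + (- real m) * flat_exp (m + 1) x) * v) UNIV" for v
      by (intro Ck_on_mult Ck_on_add Ck_on_const Suc open_UNIV)
    show ?case
      by (rule Ck_on_SucI[OF open_UNIV flat_exp_has_derivative[unfolded has_field_derivative_def]])
        (use 2 in \<open>simp add: algebra_simps\<close>)
  qed
qed

text \<open>The quotient \<open>e(b\<^sup>2 - r) / (e(b\<^sup>2 - r) + e(r - a\<^sup>2))\<close>, where \<open>r\<close> is the squared distance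
  from \<open>c\<close> and \<open>e\<close> is \<open>flat_exp 0\<close>: the two summands of the denominator have no common zero as
  \<open>a < b\<close>.\<close>

lemma smooth_bump:
  fixes c :: "'e::euclidean_space"
  assumes "0 < a" "a < b"
  obtains \<beta> :: "'e \<Rightarrow> real" where "smooth_on UNIV \<beta>"
    "\<And>x. dist c x \<le> a \<Longrightarrow> \<beta> x = 1" "\<And>x. dist c x \<ge> b \<Longrightarrow> \<beta> x = 0"
proof
  define r where "r = (\<lambda>x::'e. (x - c) \<bullet> (x - c))"
  let ?\<beta> = "\<lambda>x. flat_exp 0 (b\<^sup>2 - r x) / (flat_exp 0 (b\<^sup>2 - r x) + flat_exp 0 (r x - a\<^sup>2))"
  have r: "r x = (dist c x)\<^sup>2" for x
    by (simp add: r_def dist_norm power2_norm_eq_inner[symmetric] norm_minus_commute)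
  have ab: "a\<^sup>2 < b\<^sup>2" using assms by (simp add: power_strict_mono)
  have sr: "smooth_on UNIV r" unfolding r_def by (intro smooth_intros open_UNIV)
  have "smooth_on UNIV (\<lambda>x. flat_exp 0 (b\<^sup>2 - r x))" "smooth_on UNIV (\<lambda>x. flat_exp 0 (r x - a\<^sup>2))"
    by (auto intro!: smooth_on_compose[OF open_UNIV smooth_on_flat_exp] smooth_intros sr)
  moreover have "flat_exp 0 (b\<^sup>2 - r x) + flat_exp 0 (r x - a\<^sup>2) \<noteq> 0" for x
    using ab by (cases "r x < b\<^sup>2"; cases "r x > a\<^sup>2")
      (auto simp: flat_exp_def add_pos_pos add_pos_nonneg intro!: less_imp_neq[symmetric])
  ultimately show "smooth_on UNIV ?\<beta>" by (intro smooth_on_divide smooth_intros open_UNIV)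
  show "?\<beta> x = 1" if "dist c x \<le> a" for x
  proof -
    have "r x \<le> a\<^sup>2" using that unfolding r by (simp add: power_mono)
    with ab show ?thesis by (simp add: flat_exp_def)
  qed
  show "?\<beta> x = 0" if "dist c x \<ge> b" for x
  proof -
    have "b\<^sup>2 \<le> r x" using that assms unfolding r by (simp add: power_mono)
    then show ?thesis by (simp add: flat_exp_def)
  qed
qed

section \<open>The Hadamard lemma\<close>

text \<open>Differentiating under the integral sign in direction \<open>v\<close> replaces \<open>F\<close> by its derivative in
  direction \<open>v\<close> and the weight \<open>\<theta> t\<close> by \<open>\<theta> t * t\<close>. The arbitrary continuous weight makes the induction
  on the order of differentiability go through.\<close>

lemma Ck_on_segment_integral:
  fixes F :: "'e::euclidean_space \<Rightarrow> real"
  assumes "open S" "convex S" "a \<in> S" "Ck_on k F S" "continuous_on {0..1} \<theta>"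
  shows "Ck_on k (\<lambda>x. integral {0..1} (\<lambda>t. \<theta> t * F (a + t *\<^sub>R (x - a)))) S"
  using assms(4,5)
proof (induction k arbitrary: F \<theta>)
  have seg: "a + t *\<^sub>R (x - a) \<in> S" if "x \<in> S" "t \<in> {0..1}" for x t
    using mem_convex_alt[OF assms(2) \<open>x \<in> S\<close> assms(3), of t "1 - t"] that
    by (auto simp: algebra_simps)
  have along: "continuous_on (S \<times> {0..1}) (\<lambda>(x, t). \<theta> t *\<^sub>R G (a + t *\<^sub>R (x - a)))"
    if "continuous_on S G" "continuous_on {0..1} \<theta>"
    for G :: "'e \<Rightarrow> 'z::real_normed_vector" and \<theta>
  proof -
    have "continuous_on (S \<times> {0..1}) (\<lambda>p. G (a + snd p *\<^sub>R (fst p - a)))"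
      by (rule continuous_on_compose2[OF that(1)]) (use seg in \<open>auto intro!: continuous_intros\<close>)
    moreover have "continuous_on (S \<times> {0..1}) (\<lambda>p. \<theta> (snd p))"
      by (rule continuous_on_compose2[OF that(2)]) (auto intro!: continuous_intros)
    ultimately show ?thesis by (auto intro: continuous_intros simp: case_prod_unfold)
  qed
  {
    case 0
    then show ?case
      using integral_continuous_on_param[of S 0 1 "\<lambda>x t. \<theta> t * F (a + t *\<^sub>R (x - a))"] along[of F \<theta>]
      by simp
  next
    case (Suc k)
    let ?D = "\<lambda>x. frechet_derivative F (at x)"
    define D where "D = (\<lambda>x. Blinfun (?D x))"
    have D: "blinfun_apply (D x) = ?D x" if "x \<in> S" for x
      unfolding D_def
      using has_derivative_bounded_linear[OF Ck_on_derivative[OF Suc.prems(1) that]]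
      by (rule bounded_linear_Blinfun_apply)
    have cD: "continuous_on S D"
    proof (rule continuous_on_blinfun_componentwise)
      fix i :: 'e
      have "Ck_on k (\<lambda>x. ?D x i) S" using Suc.prems(1) by simp
      then have "continuous_on S (\<lambda>x. ?D x i)" by (rule Ck_on_imp_continuous_on)
      then show "continuous_on S (\<lambda>x. blinfun_apply (D x) i)"
        using D by (simp cong: continuous_on_cong_simp)
    qed
    have c\<theta>: "continuous_on {0..1} (\<lambda>t. \<theta> t * t)" using Suc.prems(2) by (intro continuous_intros)
    let ?G = "\<lambda>x t. (\<theta> t * t) *\<^sub>R D (a + t *\<^sub>R (x - a))"
    have cF: "continuous_on S F"
      using Suc.prems(1) by (auto intro!: continuous_at_imp_continuous_on differentiable_imp_continuous_within)
    have slice: "continuous_on {0..1} (\<lambda>t. H (x, t))" if "continuous_on (S \<times> {0..1}) H" "x \<in> S"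
      for H :: "'e \<times> real \<Rightarrow> 'z::real_normed_vector" and x
      by (rule continuous_on_compose2[OF that(1)]) (use that(2) in \<open>auto intro!: continuous_intros\<close>)
    have der_blinfun: "((\<lambda>x. integral (cbox 0 1) (\<lambda>t. \<theta> t * F (a + t *\<^sub>R (x - a)))) has_derivative
        integral (cbox 0 1) (?G x)) (at x within S)" if "x \<in> S" for x
    proof (rule leibniz_rule[OF _ _ _ that assms(2)])
      fix y t assume y: "y \<in> S" "t \<in> cbox 0 (1::real)"
      then have "(F has_derivative ?D (a + t *\<^sub>R (y - a))) (at (a + t *\<^sub>R (y - a)))"
        using Ck_on_derivative[OF Suc.prems(1) seg] by simp
      moreover have "((\<lambda>y. a + t *\<^sub>R (y - a)) has_derivative (\<lambda>v. t *\<^sub>R v)) (at y within S)"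
        by (auto intro!: derivative_eq_intros)
      ultimately
      have "((\<lambda>y. F (a + t *\<^sub>R (y - a))) has_derivative (\<lambda>v. ?D (a + t *\<^sub>R (y - a)) (t *\<^sub>R v))) (at y within S)"
        by (rule has_derivative_compose[rotated])
      from has_derivative_mult_right[OF this, of "\<theta> t"]
      show "((\<lambda>y. \<theta> t * F (a + t *\<^sub>R (y - a))) has_derivative blinfun_apply (?G y t)) (at y within S)"
        by (rule has_derivative_eq_rhs)
          (use y seg in \<open>auto simp: D[symmetric] blinfun.bilinear_simps fun_eq_iff\<close>)
    next
      fix y assume "y \<in> S"
      then show "(\<lambda>t. \<theta> t * F (a + t *\<^sub>R (y - a))) integrable_on cbox 0 1"
        using slice[OF along[OF cF Suc.prems(2)]] by (intro integrable_continuous) simp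
    next
      show "continuous_on (S \<times> cbox 0 1) (\<lambda>(x, t). ?G x t)" using along[OF cD c\<theta>] by simp
    qed
    have eval: "blinfun_apply (integral (cbox 0 1) (?G x)) v
        = integral {0..1} (\<lambda>t. \<theta> t * t * ?D (a + t *\<^sub>R (x - a)) v)" if "x \<in> S" for x v
    proof -
      have "?G x integrable_on cbox 0 1"
        using slice[OF along[OF cD c\<theta>] that] by (intro integrable_continuous) simp
      then show ?thesis
        using D seg that by (subst blinfun_apply_integral) (auto simp: blinfun.bilinear_simps intro!: integral_cong)
    qed
    have der: "((\<lambda>x. integral {0..1} (\<lambda>t. \<theta> t * F (a + t *\<^sub>R (x - a)))) has_derivative
        (\<lambda>v. integral {0..1} (\<lambda>t. \<theta> t * t * ?D (a + t *\<^sub>R (x - a)) v))) (at x)" if "x \<in> S" for x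
    proof -
      have "blinfun_apply (integral (cbox 0 1) (?G x))
          = (\<lambda>v. integral {0..1} (\<lambda>t. \<theta> t * t * ?D (a + t *\<^sub>R (x - a)) v))"
        by (rule ext) (rule eval[OF that])
      then show ?thesis
        using der_blinfun[OF that] by (simp add: at_within_open[OF that assms(1)])
    qed
    show ?case
    proof (rule Ck_on_SucI[OF assms(1) der])
      fix v
      show "Ck_on k (\<lambda>x. integral {0..1} (\<lambda>t. \<theta> t * t * ?D (a + t *\<^sub>R (x - a)) v)) S"
        by (rule Suc.IH[OF _ c\<theta>]) (use Suc.prems(1) in simp)
    qed
  }
qed

text \<open>The fundamental theorem of calculus along the segment from \<open>a\<close> to \<open>x\<close>:
  \<open>h i x\<close> is the mean of the partial derivative in direction \<open>i\<close> over that segment. It is smooth in \<open>x\<close>,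
  so a derivation applied to the identity sees only the values \<open>h i a\<close>.\<close>

lemma Hadamard:
  fixes F :: "'e::euclidean_space \<Rightarrow> real"
  assumes "open S" "convex S" "a \<in> S" "smooth_on S F"
  obtains h where "\<And>i. smooth_on S (h i)"
    "\<And>x. x \<in> S \<Longrightarrow> F x = F a + (\<Sum>i\<in>Basis. ((x - a) \<bullet> i) * h i x)"
    "\<And>i. h i a = frechet_derivative F (at a) i"
proof
  let ?D = "\<lambda>x. frechet_derivative F (at x)"
  define h where "h = (\<lambda>i x. integral {0..1} (\<lambda>t. 1 * ?D (a + t *\<^sub>R (x - a)) i))"
  show "smooth_on S (h i)" for i
    unfolding h_def smooth_on_def
    by (intro allI Ck_on_segment_integral[OF assms(1-3)] continuous_intros
        smooth_onD[OF smooth_on_frechet_derivative[OF assms(4)]])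
  show "h i a = ?D a i" for i by (simp add: h_def)
  fix x assume x: "x \<in> S"
  have seg: "a + t *\<^sub>R (x - a) \<in> S" if "t \<in> {0..1}" for t
    using mem_convex_alt[OF assms(2) \<open>x \<in> S\<close> assms(3), of t "1 - t"] that
    by (auto simp: algebra_simps)
  have "((\<lambda>t. F (a + t *\<^sub>R (x - a))) has_vector_derivative ?D (a + t *\<^sub>R (x - a)) (x - a)) (at t within {0..1})"
    if "t \<in> {0..1}" for t
  proof -
    have F: "(F has_derivative ?D (a + t *\<^sub>R (x - a))) (at (a + t *\<^sub>R (x - a)))"
      using smooth_on_imp_has_derivative[OF assms(4) seg[OF that]] .
    have "((\<lambda>t. a + t *\<^sub>R (x - a)) has_derivative (\<lambda>s. s *\<^sub>R (x - a))) (at t within {0..1})"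
      by (auto intro!: derivative_eq_intros)
    from this F
    have "((\<lambda>t. F (a + t *\<^sub>R (x - a))) has_derivative (\<lambda>s. ?D (a + t *\<^sub>R (x - a)) (s *\<^sub>R (x - a)))) (at t within {0..1})"
      by (rule has_derivative_compose)
    then show ?thesis
      unfolding has_vector_derivative_def
      by (simp add: linear_scale[OF has_derivative_linear[OF F]])
  qed
  from fundamental_theorem_of_calculus[OF _ this]
  have "integral {0..1} (\<lambda>t. ?D (a + t *\<^sub>R (x - a)) (x - a)) = F x - F a"
    by (auto intro: integral_unique)
  also have "integral {0..1} (\<lambda>t. ?D (a + t *\<^sub>R (x - a)) (x - a))
      = integral {0..1} (\<lambda>t. \<Sum>i\<in>Basis. ((x - a) \<bullet> i) * ?D (a + t *\<^sub>R (x - a)) i)"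
  proof (rule integral_cong)
    fix t :: real assume "t \<in> {0..1}"
    then have lin: "linear (?D (a + t *\<^sub>R (x - a)))"
      using smooth_on_imp_has_derivative[OF assms(4) seg] has_derivative_linear by blast
    have "?D (a + t *\<^sub>R (x - a)) (x - a) = ?D (a + t *\<^sub>R (x - a)) (\<Sum>i\<in>Basis. ((x - a) \<bullet> i) *\<^sub>R i)"
      by (subst euclidean_representation) (rule refl)
    also have "\<dots> = (\<Sum>i\<in>Basis. ((x - a) \<bullet> i) * ?D (a + t *\<^sub>R (x - a)) i)"
      by (simp add: linear_sum[OF lin] linear_scale[OF lin] del: euclidean_representation)
    finally show "?D (a + t *\<^sub>R (x - a)) (x - a) = (\<Sum>i\<in>Basis. ((x - a) \<bullet> i) * ?D (a + t *\<^sub>R (x - a)) i)" .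
  qed
  also have "\<dots> = (\<Sum>i\<in>Basis. ((x - a) \<bullet> i) * h i x)"
  proof -
    have "(\<lambda>t. ?D (a + t *\<^sub>R (x - a)) i) integrable_on {0..1}" for i
    proof (rule integrable_continuous_real)
      show "continuous_on {0..1} (\<lambda>t. ?D (a + t *\<^sub>R (x - a)) i)"
        by (rule continuous_on_compose2[OF smooth_on_imp_continuous_on[OF smooth_on_frechet_derivative[OF assms(4)]]])
          (use seg in \<open>auto intro!: continuous_intros\<close>)
    qed
    then show ?thesis unfolding h_def
      by (subst integral_sum) (auto intro: integrable_on_mult_right)
  qed
  finally show "F x = F a + (\<Sum>i\<in>Basis. ((x - a) \<bullet> i) * h i x)" by simp
qed

section \<open>Smooth functions and tangent vectors on a manifold\<close>

lemma sum_fun_apply: "(\<Sum>i\<in>I. F i) x = (\<Sum>i\<in>I. F i x :: 'b::comm_monoid_add)"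
  by (induction I rule: infinite_finite_induct) auto

lemma chart_facts:
  assumes "smooth_manifold A" "(U, c) \<in> A"
  shows "open U" "open (c ` U)" "continuous_on U c" "continuous_on (c ` U) (inv_into U c)"
    "\<And>q. q \<in> U \<Longrightarrow> inv_into U c (c q) = q"
    "\<And>x. x \<in> c ` U \<Longrightarrow> inv_into U c x \<in> U" "\<And>x. x \<in> c ` U \<Longrightarrow> c (inv_into U c x) = x"
proof -
  have "\<forall>(U, c)\<in>A. open U \<and> open (c ` U) \<and> homeomorphism U (c ` U) c (inv_into U c)"
    using assms(1) unfolding smooth_manifold_def by (elim conjE)
  from bspec[OF this assms(2)] have H: "open U" "open (c ` U)" "homeomorphism U (c ` U) c (inv_into U c)"
    by simp_all
  from H(1,2) homeomorphism_cont1[OF H(3)] homeomorphism_cont2[OF H(3)]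
  show "open U" "open (c ` U)" "continuous_on U c" "continuous_on (c ` U) (inv_into U c)" .
  from H(3) show "\<And>q. q \<in> U \<Longrightarrow> inv_into U c (c q) = q" "\<And>x. x \<in> c ` U \<Longrightarrow> c (inv_into U c x) = x"
    unfolding homeomorphism_def by (elim conjE, blast)+
  show "\<And>x. x \<in> c ` U \<Longrightarrow> inv_into U c x \<in> U" by (rule inv_into_into)
qed

lemma chart_at:
  assumes "smooth_manifold A"
  obtains U c where "(U, c) \<in> A" "p \<in> U"
proof -
  have "p \<in> (\<Union>(U, c)\<in>A. U)" using assms unfolding smooth_manifold_def by (elim conjE) simp
  then show ?thesis using that by blast
qed

lemma transition_smooth:
  assumes "smooth_manifold A" "(U, c) \<in> A" "(V, d) \<in> A"
  shows "smooth_on (c ` (U \<inter> V)) (d \<circ> inv_into U c)"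
proof -
  have "\<forall>(U, c)\<in>A. \<forall>(V, d)\<in>A. smooth_on (c ` (U \<inter> V)) (d \<circ> inv_into U c)"
    using assms(1) unfolding smooth_manifold_def by (elim conjE)
  from bspec[OF bspec[OF this assms(2), simplified] assms(3)] show ?thesis by simp
qed

lemma open_chart_image:
  assumes "smooth_manifold A" "(U, c) \<in> A" "open W" "W \<subseteq> U"
  shows "open (c ` W)"
proof -
  note ch = chart_facts[OF assms(1,2)]
  have "c ` W = c ` U \<inter> inv_into U c -` W" using ch(5,7) assms(4) by force
  then show ?thesis using ch(4) assms(3) unfolding continuous_on_open_vimage[OF ch(2)] by (metis Int_commute)
qed

lemma smooth_fun_chart: "smooth_fun A f \<Longrightarrow> (U, c) \<in> A \<Longrightarrow> smooth_on (c ` U) (f \<circ> inv_into U c)"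
  unfolding smooth_fun_def by blast

text \<open>Smoothness may be checked near each point in one chart of the atlas around it, since changes of
  chart are smooth.\<close>

lemma smooth_fun_locallyI:
  assumes A: "smooth_manifold A"
    and loc: "\<And>p. \<exists>U c W. (U, c) \<in> A \<and> open W \<and> p \<in> W \<and> W \<subseteq> U \<and> smooth_on (c ` W) (f \<circ> inv_into U c)"
  shows "smooth_fun A f"
  unfolding smooth_fun_def
proof clarify
  fix V d assume V: "(V, d) \<in> A"
  note cV = chart_facts[OF A V]
  show "smooth_on (d ` V) (f \<circ> inv_into V d)"
  proof (rule smooth_on_locally)
    fix y assume y: "y \<in> d ` V"
    let ?p = "inv_into V d y"
    from loc obtain U c W where W: "(U, c) \<in> A" "open W" "?p \<in> W" "W \<subseteq> U"
      "smooth_on (c ` W) (f \<circ> inv_into U c)" by blast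
    note cU = chart_facts[OF A W(1)]
    let ?T = "d ` (V \<inter> W)"
    have T: "open ?T" by (rule open_chart_image[OF A V]) (use W(2) cV(1) in auto)
    have "smooth_on ?T (\<lambda>x. (f \<circ> inv_into U c) ((c \<circ> inv_into V d) x))"
    proof (rule smooth_on_compose[OF T W(5)])
      show "smooth_on ?T (c \<circ> inv_into V d)"
        by (rule smooth_on_subset[OF transition_smooth[OF A V W(1)]]) (use W(4) in auto)
      show "(c \<circ> inv_into V d) ` ?T \<subseteq> c ` W" using cV(5) by auto
    qed
    then have "smooth_on ?T (f \<circ> inv_into V d)"
      by (rule smooth_on_cong[OF T, rotated]) (use cV(5) cU(5) W(4) in \<open>auto simp: subset_iff\<close>)
    moreover have "y \<in> ?T" using cV(6,7)[OF y] W(3) by (intro image_eqI[of _ _ ?p]) auto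
    ultimately show "\<exists>T. open T \<and> y \<in> T \<and> smooth_on T (f \<circ> inv_into V d)" using T by blast
  qed
qed

lemma smooth_map_continuous: "smooth_map A B F \<Longrightarrow> continuous_on UNIV F"
  unfolding smooth_map_def by (elim conjE)

lemma smooth_map_chart:
  assumes "smooth_map A B F" "(U, c) \<in> A" "(V, d) \<in> B"
  shows "smooth_on (c ` (U \<inter> F -` V)) (d \<circ> F \<circ> inv_into U c)"
proof -
  have "\<forall>(U, c)\<in>A. \<forall>(V, d)\<in>B. smooth_on (c ` (U \<inter> F -` V)) (d \<circ> F \<circ> inv_into U c)"
    using assms(1) unfolding smooth_map_def by (elim conjE)
  from bspec[OF bspec[OF this assms(2), simplified] assms(3)] show ?thesis by simp
qed

lemma smooth_fun_compose:
  assumes A: "smooth_manifold A" and B: "smooth_manifold B"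
    and F: "smooth_map A B F" and f: "smooth_fun B f"
  shows "smooth_fun A (f \<circ> F)"
proof (rule smooth_fun_locallyI[OF A])
  fix p
  obtain U c where U: "(U, c) \<in> A" "p \<in> U" using chart_at[OF A] .
  obtain V d where V: "(V, d) \<in> B" "F p \<in> V" using chart_at[OF B] .
  note cU = chart_facts[OF A U(1)] and cV = chart_facts[OF B V(1)]
  let ?W = "U \<inter> F -` V"
  have "open (F -` V)"
    using smooth_map_continuous[OF F] cV(1) by (simp add: continuous_on_open_vimage)
  then have W: "open ?W" using cU(1) by blast
  have T: "open (c ` ?W)" by (rule open_chart_image[OF A U(1) W]) auto
  have "smooth_on (c ` ?W) (\<lambda>x. (f \<circ> inv_into V d) ((d \<circ> F \<circ> inv_into U c) x))"
  proof (rule smooth_on_compose[OF T smooth_fun_chart[OF f V(1)]])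
    show "smooth_on (c ` ?W) (d \<circ> F \<circ> inv_into U c)"
      by (rule smooth_map_chart[OF F U(1) V(1)])
    show "(d \<circ> F \<circ> inv_into U c) ` c ` ?W \<subseteq> d ` V" using cU(5) by auto
  qed
  then have "smooth_on (c ` ?W) (f \<circ> F \<circ> inv_into U c)"
    by (rule smooth_on_cong[OF T, rotated]) (use cU(5) cV(5) in auto)
  then show "\<exists>U c W. (U, c) \<in> A \<and> open W \<and> p \<in> W \<and> W \<subseteq> U \<and> smooth_on (c ` W) (f \<circ> F \<circ> inv_into U c)"
    using U V W by (intro exI[of _ U] exI[of _ c] exI[of _ ?W]) auto
qed

lemma smooth_fun_pointwise:
  assumes "smooth_manifold A" "smooth_fun A f" "smooth_fun A h"
    and "\<And>(S::'e set) u v. open S \<Longrightarrow> smooth_on S u \<Longrightarrow> smooth_on S v \<Longrightarrow> smooth_on S (\<lambda>x. b (u x) (v x))"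
  shows "smooth_fun (A :: ('m::{t2_space, second_countable_topology}, 'e::euclidean_space) chart set) (\<lambda>q. b (f q) (h q))"
  unfolding smooth_fun_def
proof clarify
  fix U c assume U: "(U, c) \<in> A"
  show "smooth_on (c ` U) ((\<lambda>q. b (f q) (h q)) \<circ> inv_into U c)"
    using assms(4)[OF chart_facts(2)[OF assms(1) U] smooth_fun_chart[OF assms(2) U] smooth_fun_chart[OF assms(3) U]]
    by (simp add: o_def)
qed

lemma smooth_fun_const: "smooth_manifold A \<Longrightarrow> smooth_fun A (\<lambda>q. a)"
  unfolding smooth_fun_def o_def by (auto intro: smooth_on_const dest: chart_facts(2))

lemma smooth_fun_add:
  "smooth_manifold A \<Longrightarrow> smooth_fun A f \<Longrightarrow> smooth_fun A h \<Longrightarrow> smooth_fun A (\<lambda>q. f q + h q)"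
  by (rule smooth_fun_pointwise) (auto intro: smooth_intros)

lemma smooth_fun_diff:
  "smooth_manifold A \<Longrightarrow> smooth_fun A f \<Longrightarrow> smooth_fun A h \<Longrightarrow> smooth_fun A (\<lambda>q. f q - h q)"
  by (rule smooth_fun_pointwise) (auto intro: smooth_intros)

lemma smooth_fun_mult:
  "smooth_manifold A \<Longrightarrow> smooth_fun A f \<Longrightarrow> smooth_fun A h \<Longrightarrow> smooth_fun A (\<lambda>q. f q * h q)"
  by (rule smooth_fun_pointwise) (auto intro: smooth_intros)

lemma smooth_fun_sum:
  assumes "smooth_manifold A" "\<And>i. i \<in> I \<Longrightarrow> smooth_fun A (f i)"
  shows "smooth_fun A (\<lambda>q. \<Sum>i\<in>I. f i q)"
  using assms(2) by (induction I rule: infinite_finite_induct) (auto intro: smooth_fun_add smooth_fun_const assms(1))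

lemmas smooth_fun_intros = smooth_fun_const smooth_fun_add smooth_fun_diff smooth_fun_mult smooth_fun_sum

lemma tangent_add:
  "w \<in> tangent_space A p \<Longrightarrow> smooth_fun A f \<Longrightarrow> smooth_fun A h \<Longrightarrow> w (\<lambda>q. f q + h q) = w f + w h"
  unfolding tangent_space_def plus_fun_def by blast

lemma tangent_cmult: "w \<in> tangent_space A p \<Longrightarrow> smooth_fun A f \<Longrightarrow> w (\<lambda>q. a * f q) = a * w f"
  unfolding tangent_space_def scaleR_fun_def by simp

lemma tangent_mult:
  "w \<in> tangent_space A p \<Longrightarrow> smooth_fun A f \<Longrightarrow> smooth_fun A h \<Longrightarrow>
   w (\<lambda>q. f q * h q) = f p * w h + h p * w f"
  unfolding tangent_space_def times_fun_def by blast

lemma tangent_nonsmooth: "w \<in> tangent_space A p \<Longrightarrow> \<not> smooth_fun A f \<Longrightarrow> w f = 0"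
  unfolding tangent_space_def by blast

lemma tangent_spaceI:
  assumes "\<And>f h. smooth_fun A f \<Longrightarrow> smooth_fun A h \<Longrightarrow> w (\<lambda>q. f q + h q) = w f + w h"
    and "\<And>a f. smooth_fun A f \<Longrightarrow> w (\<lambda>q. a * f q) = a * w f"
    and "\<And>f h. smooth_fun A f \<Longrightarrow> smooth_fun A h \<Longrightarrow> w (\<lambda>q. f q * h q) = f p * w h + h p * w f"
    and "\<And>f. \<not> smooth_fun A f \<Longrightarrow> w f = 0"
  shows "w \<in> tangent_space A p"
  using assms unfolding tangent_space_def plus_fun_def times_fun_def scaleR_fun_def real_scaleR_def by blast

lemma tangent_const:
  assumes "smooth_manifold A" "w \<in> tangent_space A p"
  shows "w (\<lambda>q. a) = 0"
proof -
  have 1: "smooth_fun A (\<lambda>q. 1)" by (rule smooth_fun_const[OF assms(1)])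
  have "w (\<lambda>q. 1) = 0" using tangent_mult[OF assms(2) 1 1] by simp
  then show ?thesis using tangent_cmult[OF assms(2) 1, of a] by simp
qed

lemma tangent_diff:
  assumes "smooth_manifold A" "w \<in> tangent_space A p" "smooth_fun A f" "smooth_fun A h"
  shows "w (\<lambda>q. f q - h q) = w f - w h"
  using tangent_add[OF assms(2,3), of "\<lambda>q. -1 * h q"] tangent_cmult[OF assms(2,4), of "-1"]
    smooth_fun_mult[OF assms(1) smooth_fun_const[OF assms(1)] assms(4), of "-1"] by simp

lemma tangent_sum:
  assumes "smooth_manifold A" "w \<in> tangent_space A p" "\<And>i. i \<in> I \<Longrightarrow> smooth_fun A (f i)"
  shows "w (\<lambda>q. \<Sum>i\<in>I. f i q) = (\<Sum>i\<in>I. w (f i))"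
  using assms(3)
  by (induction I rule: infinite_finite_induct)
    (simp_all add: tangent_const[OF assms(1,2)] tangent_add[OF assms(2)] smooth_fun_sum[OF assms(1)])

text \<open>The Leibniz rule alone makes derivations local: if \<open>a\<close> equals \<open>1\<close> where \<open>b\<close> does not vanish, then
  applying \<open>w\<close> to \<open>a b = b\<close> at a point with \<open>b \<noteq> 0\<close> kills \<open>w a\<close>.\<close>

lemma tangent_bump:
  assumes "smooth_manifold A" "w \<in> tangent_space A p" "smooth_fun A a" "smooth_fun A b"
    and "\<And>q. a q * b q = b q" "b p \<noteq> 0"
  shows "w a = 0"
proof -
  have 1: "a p = 1" using assms(5)[of p] assms(6) by simp
  have "(\<lambda>q. a q * b q) = b" using assms(5) by (rule ext)
  then have "w b = a p * w b + b p * w a" using tangent_mult[OF assms(2-4)] by (simp only:)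
  then have "b p * w a = 0" unfolding 1 by simp
  then show ?thesis using assms(6) by simp
qed

lemma subspace_tangent_space:
  fixes A :: "('m, 'e::euclidean_space) chart set"
  shows "subspace (tangent_space A p)"
  by (rule subspaceI; rule tangent_spaceI)
    (simp_all add: tangent_add tangent_cmult tangent_mult tangent_nonsmooth algebra_simps)

section \<open>Global frames around a point\<close>

definition chart_fun :: "'m set \<Rightarrow> ('m \<Rightarrow> 'e) \<Rightarrow> ('e \<Rightarrow> real) \<Rightarrow> 'm \<Rightarrow> real"
  where "chart_fun U c g = (\<lambda>q. if q \<in> U then g (c q) else 0)"

text \<open>Extension by zero of a function supported in a compact part \<open>K\<close> of a chart. The preimage of
  \<open>K\<close> is compact, hence closed because the manifold is Hausdorff, so off the chart the extension vanishes on
  a whole neighbourhood.\<close>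

lemma smooth_fun_chart_fun:
  assumes A: "smooth_manifold A" and U: "(U, c) \<in> A"
    and K: "compact K" "K \<subseteq> S" "open S" "S \<subseteq> c ` U"
    and g: "smooth_on S g" "\<And>x. x \<notin> K \<Longrightarrow> g x = 0"
  shows "smooth_fun A (chart_fun U c g)"
proof (rule smooth_fun_locallyI[OF A])
  fix p
  note cU = chart_facts[OF A U]
  show "\<exists>V d W. (V, d) \<in> A \<and> open W \<and> p \<in> W \<and> W \<subseteq> V \<and> smooth_on (d ` W) (chart_fun U c g \<circ> inv_into V d)"
  proof (cases "p \<in> U")
    case True
    have "smooth_on (c ` U) g"
    proof (rule smooth_on_locally)
      fix x assume "x \<in> c ` U"
      show "\<exists>T. open T \<and> x \<in> T \<and> smooth_on T g"
      proof (cases "x \<in> K")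
        case True then show ?thesis using K g by blast
      next
        case False
        have o: "open (- K)" using K(1) by (simp add: compact_imp_closed open_Compl)
        have "smooth_on (- K) g"
          by (rule smooth_on_cong[OF o _ smooth_on_const[OF o, of 0]]) (simp add: g(2))
        then show ?thesis using o False by blast
      qed
    qed
    then have "smooth_on (c ` U) (chart_fun U c g \<circ> inv_into U c)"
      by (rule smooth_on_cong[OF cU(2), rotated]) (use cU(5) in \<open>auto simp: chart_fun_def\<close>)
    then show ?thesis using U cU(1) True by blast
  next
    case False
    obtain V d where V: "(V, d) \<in> A" "p \<in> V" using chart_at[OF A] .
    let ?K = "inv_into U c ` K"
    have "compact ?K" using K cU(4) by (intro compact_continuous_image) (auto intro: continuous_on_subset)
    then have W: "open (V - ?K)" using chart_facts(1)[OF A V(1)] by (auto intro: open_Diff compact_imp_closed)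
    have oW: "open (d ` (V - ?K))" by (rule open_chart_image[OF A V(1) W]) auto
    have "p \<notin> ?K" using False K cU(6) by auto
    moreover have "smooth_on (d ` (V - ?K)) (chart_fun U c g \<circ> inv_into V d)"
    proof (rule smooth_on_cong[OF oW _ smooth_on_const[OF oW, of 0]])
      fix y assume "y \<in> d ` (V - ?K)"
      then obtain q where q: "q \<in> V" "q \<notin> ?K" "y = d q" by blast
      have "c q \<notin> K" if "q \<in> U" using q(2) cU(5)[OF that] by (metis image_eqI)
      then show "0 = (chart_fun U c g \<circ> inv_into V d) y"
        using q chart_facts(5)[OF A V(1) q(1)] by (auto simp: chart_fun_def g(2))
    qed
    ultimately show ?thesis using V W by (intro exI[of _ V] exI[of _ d] exI[of _ "V - ?K"]) auto
  qed
qed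

text \<open>The coordinate field of the chart in direction \<open>i\<close>, cut off by \<open>b\<close>. It is zero on functions that
  are not smooth, as the representation of tangent vectors demands.\<close>

definition partial_field ::
  "('m, 'e::euclidean_space) chart set \<Rightarrow> 'm set \<Rightarrow> ('m \<Rightarrow> 'e) \<Rightarrow> ('e \<Rightarrow> real) \<Rightarrow> 'e \<Rightarrow> 'm vfield"
where
  "partial_field A U c b i = (\<lambda>q f. if smooth_fun A f
     then chart_fun U c (\<lambda>x. b x * frechet_derivative (f \<circ> inv_into U c) (at x) i) q else 0)"

lemma partial_field_in_vector_fields:
  assumes A: "smooth_manifold A" and U: "(U, c) \<in> A"
    and K: "compact K" "K \<subseteq> c ` U"
    and b: "smooth_on UNIV b" "\<And>x. x \<notin> K \<Longrightarrow> b x = 0"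
  shows "partial_field A U c b i \<in> vector_fields A"
  unfolding vector_fields_def
proof (intro CollectI conjI allI impI)
  note cU = chart_facts[OF A U]
  fix q
  have D: "((f \<circ> inv_into U c) has_derivative frechet_derivative (f \<circ> inv_into U c) (at (c q))) (at (c q))"
    if "q \<in> U" "smooth_fun A f" for f
    by (rule smooth_on_imp_has_derivative[OF smooth_fun_chart[OF that(2) U]]) (use that(1) in blast)
  show "partial_field A U c b i q \<in> tangent_space A q"
  proof (rule tangent_spaceI, goal_cases)
    case (1 f h)
    have "frechet_derivative ((\<lambda>q. f q + h q) \<circ> inv_into U c) (at (c q)) i
        = frechet_derivative (f \<circ> inv_into U c) (at (c q)) i + frechet_derivative (h \<circ> inv_into U c) (at (c q)) i"
      if "q \<in> U"
      using frechet_derivative_at[OF has_derivative_add[OF D[OF that 1(1)] D[OF that 1(2)]]]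
      by (simp add: o_def fun_eq_iff)
    then show ?case using 1 by (simp add: partial_field_def chart_fun_def smooth_fun_add[OF A] algebra_simps)
  next
    case (2 a f)
    have "frechet_derivative ((\<lambda>q. a * f q) \<circ> inv_into U c) (at (c q)) i
        = a * frechet_derivative (f \<circ> inv_into U c) (at (c q)) i"
      if "q \<in> U"
      using frechet_derivative_at[OF has_derivative_mult_right[OF D[OF that 2], of a]]
      by (simp add: o_def fun_eq_iff)
    then show ?case
      using 2 by (simp add: partial_field_def chart_fun_def smooth_fun_mult[OF A] smooth_fun_const[OF A])
  next
    case (3 f h)
    have "frechet_derivative ((\<lambda>q. f q * h q) \<circ> inv_into U c) (at (c q)) i
        = f q * frechet_derivative (h \<circ> inv_into U c) (at (c q)) i + frechet_derivative (f \<circ> inv_into U c) (at (c q)) i * h q"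
      if "q \<in> U"
      using frechet_derivative_at[OF has_derivative_mult[OF D[OF that 3(1)] D[OF that 3(2)]]]
      by (simp add: o_def fun_eq_iff cU(5)[OF that])
    then show ?case using 3 by (simp add: partial_field_def chart_fun_def smooth_fun_mult[OF A] algebra_simps)
  next
    case (4 f)
    then show ?case by (simp add: partial_field_def)
  qed
next
  fix f assume f: "smooth_fun A f"
  have "smooth_fun A (chart_fun U c (\<lambda>x. b x * frechet_derivative (f \<circ> inv_into U c) (at x) i))"
    using chart_facts(2)[OF A U]
    by (intro smooth_fun_chart_fun[OF A U K _ order_refl] smooth_on_mult smooth_on_frechet_derivative
        smooth_fun_chart[OF f U] smooth_on_subset[OF b(1)]) (auto simp: b(2))
  then show "smooth_fun A (\<lambda>q. partial_field A U c b i q f)" using f by (simp add: partial_field_def)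
qed

text \<open>A coordinate frame around \<open>p\<close> in a form that mentions globally defined objects only: where the
  cutoff \<open>\<rho>\<close> is \<open>1\<close>, the \<open>f i\<close> are coordinates and the \<open>E i\<close> the coordinate fields. The vanishing of
  the differential of \<open>\<rho>\<close> at \<open>p\<close> lets \<open>\<rho>\<close> pass through derivatives at \<open>p\<close> as if it were constant.\<close>

definition frame_at ::
  "('m, 'e::euclidean_space) chart set \<Rightarrow> 'm \<Rightarrow> ('m \<Rightarrow> real) \<Rightarrow> ('e \<Rightarrow> 'm \<Rightarrow> real) \<Rightarrow> ('e \<Rightarrow> 'm vfield) \<Rightarrow> bool"
where
  "frame_at A p \<rho> f E \<longleftrightarrow> smooth_fun A \<rho> \<and> \<rho> p = 1 \<and> (\<forall>w\<in>tangent_space A p. w \<rho> = 0) \<and>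
     (\<forall>i\<in>Basis. smooth_fun A (f i) \<and> E i \<in> vector_fields A) \<and>
     (\<forall>q. \<forall>i\<in>Basis. \<forall>j\<in>Basis. E i q (f j) = \<rho> q * (if i = j then 1 else 0)) \<and>
     (\<forall>q. \<forall>w\<in>tangent_space A q. \<rho> q *\<^sub>R w = (\<Sum>i\<in>Basis. w (f i) *\<^sub>R E i q))"

text \<open>Three nested bump functions \<open>b1\<close>, \<open>b2\<close>, \<open>b3\<close> in a coordinate ball, each equal to \<open>1\<close> on the support
  of the preceding one. The cutoff and the fields use \<open>b2\<close>, the coordinate functions use \<open>b3\<close>. Where
  \<open>b2\<close> is nonzero, \<open>b3\<close> has value \<open>1\<close> and is killed by derivations, so multiplying the Hadamard
  expansion of \<open>k\<close> around the point by \<open>b3\<^sup>2\<close> turns it into an identity between global smooth functions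
  to which a derivation can be applied. The bump \<open>b1\<close> shows that derivations at \<open>p\<close> kill \<open>\<rho>\<close>.\<close>

theorem frame_exists:
  fixes A :: "('m::{t2_space, second_countable_topology}, 'e::euclidean_space) chart set"
  assumes A: "smooth_manifold A"
  obtains \<rho> f E where "frame_at A p \<rho> f E"
proof -
  obtain U c where U: "(U, c) \<in> A" "p \<in> U" using chart_at[OF A] .
  note cU = chart_facts[OF A U(1)]
  obtain R where R: "R > 0" "ball (c p) R \<subseteq> c ` U"
    using cU(2) U(2) by (meson image_eqI openE)
  let ?S = "ball (c p) R"
  \<comment> \<open>Six equally spaced radii below \<open>R\<close>, so that each bump has room to fall from \<open>1\<close> to \<open>0\<close>.\<close>
  have bump: "\<exists>b :: 'e \<Rightarrow> real. smooth_on UNIV b \<and> (\<forall>x. dist (c p) x \<le> R * s \<longrightarrow> b x = 1) \<and>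
      (\<forall>x. dist (c p) x \<ge> R * t \<longrightarrow> b x = 0)" if "0 < s" "s < t" for s t :: real
    using smooth_bump[of "R * s" "R * t" "c p"] that R(1) by (metis mult_pos_pos mult_strict_left_mono)
  obtain b1 where b1: "smooth_on UNIV b1" "\<And>x. dist (c p) x \<le> R * (1/7) \<Longrightarrow> b1 x = 1"
    "\<And>x. dist (c p) x \<ge> R * (2/7) \<Longrightarrow> b1 x = (0::real)" using bump[of "1/7" "2/7"] by auto
  obtain b2 where b2: "smooth_on UNIV b2" "\<And>x. dist (c p) x \<le> R * (3/7) \<Longrightarrow> b2 x = 1"
    "\<And>x. dist (c p) x \<ge> R * (4/7) \<Longrightarrow> b2 x = (0::real)" using bump[of "3/7" "4/7"] by auto
  obtain b3 where b3: "smooth_on UNIV b3" "\<And>x. dist (c p) x \<le> R * (5/7) \<Longrightarrow> b3 x = 1"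
    "\<And>x. dist (c p) x \<ge> R * (6/7) \<Longrightarrow> b3 x = (0::real)" using bump[of "5/7" "6/7"] by auto
  let ?K = "cball (c p) (R * (6/7))"
  have out: "b1 x = 0" "b2 x = 0" "b3 x = 0" if "x \<notin> ?K" for x
    using b1(3) b2(3) b3(3) that R(1) by auto
  have KS: "?K \<subseteq> ?S" using R(1) by auto
  have extend: "smooth_fun A (chart_fun U c g)" if "smooth_on ?S g" "\<And>x. x \<notin> ?K \<Longrightarrow> g x = 0" for g
    by (rule smooth_fun_chart_fun[OF A U(1) compact_cball KS open_ball R(2) that])
  have extend': "smooth_fun A (chart_fun U c g)" if "smooth_on UNIV g" "\<And>x. x \<notin> ?K \<Longrightarrow> g x = 0" for g
    by (rule extend[OF smooth_on_subset[OF that(1)] that(2)]) auto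
  have sb: "smooth_fun A (chart_fun U c b1)" "smooth_fun A (chart_fun U c b2)" "smooth_fun A (chart_fun U c b3)"
    using extend'[OF b1(1)] extend'[OF b2(1)] extend'[OF b3(1)] out by blast+
  have b12: "b2 x * b1 x = b1 x" for x
    using b1(3)[of x] b2(2)[of x] R(1) by (cases "dist (c p) x \<ge> R * (2/7)") auto
  have b23: "b3 x * b2 x = b2 x" for x
    using b2(3)[of x] b3(2)[of x] R(1) by (cases "dist (c p) x \<ge> R * (4/7)") auto
  define \<rho> where "\<rho> = chart_fun U c b2"
  define f where "f = (\<lambda>i::'e. chart_fun U c (\<lambda>x. b3 x * (x \<bullet> i)))"
  define E where "E = (\<lambda>i. partial_field A U c b2 i)"
  have f: "smooth_fun A (f i)" for i
    unfolding f_def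
    by (rule extend') (auto intro!: smooth_on_mult smooth_on_inner smooth_on_id smooth_on_const b3(1) simp: out)
  have E: "E i \<in> vector_fields A" for i
    unfolding E_def
    by (rule partial_field_in_vector_fields[OF A U(1) compact_cball _ b2(1) out(2)]) (use KS R(2) in auto)
  have "\<rho> p = 1" using b2(2)[of "c p"] R(1) U(2) by (simp add: \<rho>_def chart_fun_def)
  moreover have "w \<rho> = 0" if "w \<in> tangent_space A p" for w
    unfolding \<rho>_def
    by (rule tangent_bump[OF A that sb(2,1)]) (use b12 b1(2)[of "c p"] R(1) U(2) in \<open>auto simp: chart_fun_def\<close>)
  moreover have "E i q (f j) = \<rho> q * (if i = j then 1 else 0)" if ij: "i \<in> Basis" "j \<in> Basis" for i j q
  proof (cases "q \<in> U \<and> dist (c p) (c q) < R * (4/7)")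
    case True
    have "((\<lambda>x. x \<bullet> j) has_derivative (\<lambda>v. v \<bullet> j)) (at (c q))"
      by (auto intro!: derivative_eq_intros)
    then have "((f j \<circ> inv_into U c) has_derivative (\<lambda>v. v \<bullet> j)) (at (c q))"
    proof (rule has_derivative_transform_within_open)
      show "open (ball (c p) (R * (4/7)))" "c q \<in> ball (c p) (R * (4/7))" using True by auto
      fix x assume x: "x \<in> ball (c p) (R * (4/7))"
      then have "x \<in> ?S" using R(1) by auto
      then have "x \<in> c ` U" using R(2) by blast
      then show "x \<bullet> j = (f j \<circ> inv_into U c) x"
        using b3(2)[of x] x R(1) cU(6,7)[of x] by (simp add: f_def chart_fun_def)
    qed
    from frechet_derivative_at[OF this, symmetric] show ?thesis
      using True f ij by (simp add: E_def partial_field_def chart_fun_def \<rho>_def inner_Basis)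
  next
    case False
    then have "\<rho> q = 0" "E i q (f j) = 0"
      using b2(3) by (auto simp: E_def partial_field_def chart_fun_def \<rho>_def)
    then show ?thesis by simp
  qed
  moreover have "\<rho> q *\<^sub>R w = (\<Sum>i\<in>Basis. w (f i) *\<^sub>R E i q)" if w: "w \<in> tangent_space A q" for q w
  proof
    fix k
    show "(\<rho> q *\<^sub>R w) k = (\<Sum>i\<in>Basis. w (f i) *\<^sub>R E i q) k"
    proof (cases "smooth_fun A k \<and> \<rho> q \<noteq> 0")
      case False
      then consider "\<not> smooth_fun A k" | "\<rho> q = 0" by blast
      then show ?thesis
      proof cases
        case 1
        then show ?thesis using w by (simp add: sum_fun_apply tangent_nonsmooth E_def partial_field_def)
      next
        case 2
        then have "E i q k = 0" for i by (auto simp: E_def partial_field_def chart_fun_def \<rho>_def)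
        then show ?thesis using 2 by (simp add: sum_fun_apply)
      qed
    next
      case True
      then have k: "smooth_fun A k" and q: "q \<in> U" "b2 (c q) \<noteq> 0"
        by (auto simp: \<rho>_def chart_fun_def split: if_splits)
      have "c q \<in> ?S" using q(2) out(2) KS by blast
      obtain h where h: "\<And>i. smooth_on ?S (h i)"
        "\<And>x. x \<in> ?S \<Longrightarrow> (k \<circ> inv_into U c) x = (k \<circ> inv_into U c) (c q) + (\<Sum>i\<in>Basis. ((x - c q) \<bullet> i) * h i x)"
        "\<And>i. h i (c q) = frechet_derivative (k \<circ> inv_into U c) (at (c q)) i"
        using Hadamard[OF open_ball convex_ball \<open>c q \<in> ?S\<close> smooth_on_subset[OF smooth_fun_chart[OF k U(1)] R(2)]]
        by blast
      let ?b = "chart_fun U c b3" and ?h = "\<lambda>i. chart_fun U c (\<lambda>x. b3 x * h i x)"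
      have sh: "smooth_fun A (?h i)" for i
        by (rule extend) (auto intro!: smooth_on_mult h(1) smooth_on_subset[OF b3(1)] simp: out)
      have b3q: "b3 (c q) = 1" using b23[of "c q"] q(2) by simp
      have wb: "w ?b = 0"
        by (rule tangent_bump[OF A w sb(3,2)]) (use b23 q in \<open>auto simp: chart_fun_def\<close>)
      \<comment> \<open>One factor \<open>b3\<close> goes to the coordinates, the other makes \<open>h i\<close> global.\<close>
      have eq: "?b x * ?b x * k x = k q * (?b x * ?b x) + (\<Sum>i\<in>Basis. (f i x - (c q \<bullet> i) * ?b x) * ?h i x)" for x
      proof (cases "x \<in> U \<and> c x \<in> ?S")
        case True
        have "(\<Sum>i\<in>Basis. (f i x - (c q \<bullet> i) * ?b x) * ?h i x)
            = ?b x * ?b x * (\<Sum>i\<in>Basis. ((c x - c q) \<bullet> i) * h i (c x))"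
          using True by (simp add: chart_fun_def f_def sum_distrib_left inner_diff_left algebra_simps)
        moreover have "k x = k q + (\<Sum>i\<in>Basis. ((c x - c q) \<bullet> i) * h i (c x))"
          using True h(2)[of "c x"] cU(5)[of x] cU(5)[OF q(1)] by simp
        ultimately show ?thesis by (simp only:) (simp add: algebra_simps)
      next
        case False
        then have "x \<in> U \<Longrightarrow> b3 (c x) = 0" using out(3)[of "c x"] KS by blast
        then have "?b x = 0" "?h i x = 0" for i by (auto simp: chart_fun_def)
        then show ?thesis by simp
      qed
      have wbb: "w (\<lambda>x. ?b x * ?b x) = 0" using tangent_mult[OF w sb(3,3)] wb by simp
      have sbb: "smooth_fun A (\<lambda>x. ?b x * ?b x)" by (rule smooth_fun_mult[OF A sb(3,3)])
      have sf: "smooth_fun A (\<lambda>x. f i x - (c q \<bullet> i) * ?b x)" for i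
        by (intro smooth_fun_intros A f sb)
      have "w (\<lambda>x. ?b x * ?b x * k x) = w k"
        using tangent_mult[OF w sbb k] wbb q b3q by (simp add: chart_fun_def)
      also have "(\<lambda>x. ?b x * ?b x * k x) = (\<lambda>x. k q * (?b x * ?b x) + (\<Sum>i\<in>Basis. (f i x - (c q \<bullet> i) * ?b x) * ?h i x))"
        by (rule ext) (rule eq)
      also have "w \<dots> = (\<Sum>i\<in>Basis. w (\<lambda>x. (f i x - (c q \<bullet> i) * ?b x) * ?h i x))"
        by (subst tangent_add[OF w])
          (auto intro!: smooth_fun_intros A sbb sf sh simp: tangent_cmult[OF w sbb] wbb
            tangent_sum[OF A w smooth_fun_mult[OF A sf sh]])
      also have "\<dots> = (\<Sum>i\<in>Basis. w (f i) * h i (c q))"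
      proof (rule sum.cong[OF refl])
        fix i
        have "w (\<lambda>x. f i x - (c q \<bullet> i) * ?b x) = w (f i)"
          using tangent_diff[OF A w f, of "\<lambda>x. (c q \<bullet> i) * ?b x"] tangent_cmult[OF w sb(3)] wb
          by (simp add: smooth_fun_mult[OF A smooth_fun_const[OF A] sb(3)])
        moreover have "f i q - (c q \<bullet> i) * ?b q = 0" using q b3q by (simp add: f_def chart_fun_def)
        ultimately show "w (\<lambda>x. (f i x - (c q \<bullet> i) * ?b x) * ?h i x) = w (f i) * h i (c q)"
          using tangent_mult[OF w sf sh, of i i] q b3q by (simp add: chart_fun_def mult.commute)
      qed
      finally have "w k = (\<Sum>i\<in>Basis. w (f i) * h i (c q))" by (rule sym)
      then show ?thesis
        using k q by (simp add: sum_fun_apply E_def partial_field_def chart_fun_def \<rho>_def h(3) sum_distrib_left mult_ac)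
    qed
  qed
  ultimately have "frame_at A p \<rho> f E"
    unfolding frame_at_def using f E sb(2) by (auto simp: \<rho>_def)
  then show ?thesis by (rule that)
qed

section \<open>Vector fields and their extension from a point\<close>

lemmas vec_intros = subspace_add subspace_diff subspace_scale subspace_sum subspace_0 subspace_neg

lemmas tangent_space_intros = vec_intros[OF subspace_tangent_space]

lemma vector_field_tangent: "X \<in> vector_fields A \<Longrightarrow> X p \<in> tangent_space A p"
  unfolding vector_fields_def by blast

lemma vector_field_smooth: "X \<in> vector_fields A \<Longrightarrow> smooth_fun A f \<Longrightarrow> smooth_fun A (\<lambda>p. X p f)"
  unfolding vector_fields_def by blast

lemma vector_field_scale:
  assumes "smooth_manifold A" "smooth_fun A a" "X \<in> vector_fields A"
  shows "(\<lambda>p. a p *\<^sub>R X p) \<in> vector_fields A"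
  using assms unfolding vector_fields_def
  by (auto intro!: tangent_space_intros smooth_fun_mult)

lemma vector_field_diff:
  assumes "smooth_manifold A" "X \<in> vector_fields A" "Y \<in> vector_fields A"
  shows "(\<lambda>p. X p - Y p) \<in> vector_fields A"
  using assms unfolding vector_fields_def
  by (auto intro!: tangent_space_intros smooth_fun_diff)

lemma vector_field_sum:
  assumes "smooth_manifold A" "\<And>i. i \<in> I \<Longrightarrow> X i \<in> vector_fields A"
  shows "(\<lambda>p. \<Sum>i\<in>I. X i p) \<in> vector_fields A"
  using assms unfolding vector_fields_def
  by (auto intro!: tangent_space_intros smooth_fun_sum simp: sum_fun_apply)

lemma vector_field_0: "smooth_manifold A \<Longrightarrow> 0 \<in> vector_fields A"
  using vector_field_sum[of A "{}"] by (simp add: zero_fun_def)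

lemma frame_atD:
  assumes "frame_at A p \<rho> f E"
  shows "smooth_fun A \<rho>" "\<rho> p = 1" "\<And>w. w \<in> tangent_space A p \<Longrightarrow> w \<rho> = 0"
    "\<And>i. i \<in> Basis \<Longrightarrow> smooth_fun A (f i)" "\<And>i. i \<in> Basis \<Longrightarrow> E i \<in> vector_fields A"
    "\<And>i j q. i \<in> Basis \<Longrightarrow> j \<in> Basis \<Longrightarrow> E i q (f j) = \<rho> q * (if i = j then 1 else 0)"
    "\<And>q w. w \<in> tangent_space A q \<Longrightarrow> \<rho> q *\<^sub>R w = (\<Sum>i\<in>Basis. w (f i) *\<^sub>R E i q)"
    "\<And>w. w \<in> tangent_space A p \<Longrightarrow> w = (\<Sum>i\<in>Basis. w (f i) *\<^sub>R E i p)"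
proof -
  note * = assms[unfolded frame_at_def]
  show "smooth_fun A \<rho>" and 1: "\<rho> p = 1"
    and "\<And>w. w \<in> tangent_space A p \<Longrightarrow> w \<rho> = 0"
    and "\<And>i. i \<in> Basis \<Longrightarrow> smooth_fun A (f i)" "\<And>i. i \<in> Basis \<Longrightarrow> E i \<in> vector_fields A"
    and "\<And>i j q. i \<in> Basis \<Longrightarrow> j \<in> Basis \<Longrightarrow> E i q (f j) = \<rho> q * (if i = j then 1 else 0)"
    using * by blast+
  show e: "\<rho> q *\<^sub>R w = (\<Sum>i\<in>Basis. w (f i) *\<^sub>R E i q)" if "w \<in> tangent_space A q" for q w
    using * that by blast
  show "w = (\<Sum>i\<in>Basis. w (f i) *\<^sub>R E i p)" if "w \<in> tangent_space A p" for w
    using e[OF that] unfolding 1 by simp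
qed

text \<open>The extension is a combination of the frame fields with constant coefficients.\<close>

lemma extend_tangent_vector:
  assumes "smooth_manifold A" "v \<in> tangent_space A p"
  obtains V where "V \<in> vector_fields A" "V p = v"
proof -
  obtain \<rho> f E where fr: "frame_at A p \<rho> f E" by (rule frame_exists[OF assms(1)])
  show ?thesis
    by (rule that[of "\<lambda>q. \<Sum>i\<in>Basis. v (f i) *\<^sub>R E i q"])
      (use frame_atD(5,8)[OF fr] assms in
        \<open>auto intro!: vector_field_sum vector_field_scale[where a="\<lambda>_. _"] smooth_fun_const\<close>)
qed

section \<open>Linear algebra of a Riemannian metric at a point\<close>

locale riemannian =
  fixes A :: "('m::{t2_space, second_countable_topology}, 'e::euclidean_space) chart set"
    and g :: "'m \<Rightarrow> 'm tvec \<Rightarrow> 'm tvec \<Rightarrow> real"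
  assumes riemannian: "riemannian_manifold A g"
begin

abbreviation T :: "'m \<Rightarrow> 'm tvec set" where "T \<equiv> tangent_space A"

lemma manifold: "smooth_manifold A" and metric: "riemannian_metric A g"
  using riemannian unfolding riemannian_manifold_def by simp_all

lemma g_sym: "u \<in> T p \<Longrightarrow> v \<in> T p \<Longrightarrow> g p u v = g p v u"
  using metric unfolding riemannian_metric_def by blast

lemma g_pos: "u \<in> T p \<Longrightarrow> u \<noteq> 0 \<Longrightarrow> g p u u > 0"
  using metric unfolding riemannian_metric_def by blast

lemma g_eq_0: "u \<in> T p \<Longrightarrow> g p u u = 0 \<Longrightarrow> u = 0"
  using g_pos by force

lemma g_smooth: "X \<in> vector_fields A \<Longrightarrow> Y \<in> vector_fields A \<Longrightarrow> smooth_fun A (\<lambda>p. g p (X p) (Y p))"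
  using metric unfolding riemannian_metric_def by blast

lemma g_add_right: "u \<in> T p \<Longrightarrow> v \<in> T p \<Longrightarrow> w \<in> T p \<Longrightarrow> g p u (v + w) = g p u v + g p u w"
  using metric unfolding riemannian_metric_def linear_at_def by blast

lemma g_scale_right: "u \<in> T p \<Longrightarrow> v \<in> T p \<Longrightarrow> g p u (a *\<^sub>R v) = a * g p u v"
  using metric unfolding riemannian_metric_def linear_at_def real_scaleR_def by blast

lemma g_zero_right: "u \<in> T p \<Longrightarrow> g p u 0 = 0"
  using g_scale_right[of u p 0 0] by (simp add: tangent_space_intros)

lemma g_diff_right: "u \<in> T p \<Longrightarrow> v \<in> T p \<Longrightarrow> w \<in> T p \<Longrightarrow> g p u (v - w) = g p u v - g p u w"
  using g_add_right[of u p v "(-1) *\<^sub>R w"] g_scale_right[of u p w "-1"] tangent_space_intros(3)[of w A p "-1"]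
  by simp

lemma g_sum_right:
  assumes "u \<in> T p" "\<And>i. i \<in> I \<Longrightarrow> v i \<in> T p"
  shows "g p u (\<Sum>i\<in>I. a i *\<^sub>R v i) = (\<Sum>i\<in>I. a i * g p u (v i))"
  using assms
  by (induction I rule: infinite_finite_induct)
    (simp_all add: g_zero_right g_add_right g_scale_right tangent_space_intros)

lemma g_add_left: "u \<in> T p \<Longrightarrow> v \<in> T p \<Longrightarrow> w \<in> T p \<Longrightarrow> g p (v + w) u = g p v u + g p w u"
  using g_add_right g_sym by (simp add: tangent_space_intros)

lemma g_scale_left: "u \<in> T p \<Longrightarrow> v \<in> T p \<Longrightarrow> g p (a *\<^sub>R v) u = a * g p v u"
  using g_scale_right g_sym by (simp add: tangent_space_intros)

lemma g_zero_left: "u \<in> T p \<Longrightarrow> g p 0 u = 0"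
  using g_zero_right[of u p] g_sym[of u p 0] tangent_space_intros(5)[of A p] by simp

lemma g_diff_left: "u \<in> T p \<Longrightarrow> v \<in> T p \<Longrightarrow> w \<in> T p \<Longrightarrow> g p (v - w) u = g p v u - g p w u"
  using g_diff_right g_sym by (simp add: tangent_space_intros)

lemma g_sum_left:
  assumes "u \<in> T p" "\<And>i. i \<in> I \<Longrightarrow> v i \<in> T p"
  shows "g p (\<Sum>i\<in>I. a i *\<^sub>R v i) u = (\<Sum>i\<in>I. a i * g p (v i) u)"
  using g_sum_right[OF assms] g_sym assms by (simp add: tangent_space_intros)

text \<open>Gram-Schmidt: given projections to the span of \<open>C\<close>, the part \<open>e\<close> of a further vector \<open>c\<close>
  orthogonal to \<open>C\<close> supplies the correction. If \<open>e = 0\<close>, the division by \<open>g(e, e) = 0\<close> yields the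
  coefficient \<open>0\<close>, which is the right one.\<close>

lemma orth_span:
  assumes "finite C" "C \<subseteq> T p" "x \<in> T p"
  shows "\<exists>v\<in>span C. \<forall>u\<in>span C. g p (x - v) u = 0"
proof -
  have span_sub: "span D \<subseteq> T p" if "D \<subseteq> T p" for D
    using that by (simp add: span_minimal subspace_tangent_space)
  have orth: "\<forall>u\<in>span D. g p y u = 0" if "D \<subseteq> T p" "y \<in> T p" "\<And>u. u \<in> D \<Longrightarrow> g p y u = 0" for D y
  proof
    have "span D \<subseteq> {u \<in> T p. g p y u = 0}"
      using that by (intro span_minimal)
        (auto simp: subspace_def g_zero_right g_add_right g_scale_right intro!: tangent_space_intros)
    then show "g p y u = 0" if "u \<in> span D" for u using that by blast
  qed
  from assms show ?thesis
  proof (induction C arbitrary: x rule: finite_induct)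
    case empty
    then show ?case using g_zero_right[of x p] by (simp add: zero_fun_def)
  next
    case (insert c C)
    then have cC: "c \<in> T p" "C \<subseteq> T p" by auto
    obtain v where v: "v \<in> span C" "\<And>u. u \<in> span C \<Longrightarrow> g p (x - v) u = 0"
      using insert.IH[OF cC(2) insert.prems(2)] by blast
    obtain d where d: "d \<in> span C" "\<And>u. u \<in> span C \<Longrightarrow> g p (c - d) u = 0"
      using insert.IH[OF cC(2,1)] by blast
    have T: "v \<in> T p" "d \<in> T p" using v(1) d(1) span_sub[OF cC(2)] by auto
    have mono: "span C \<subseteq> span (insert c C)" by (rule span_mono) auto
    let ?e = "c - d"
    have e: "?e \<in> T p" using T(2) cC(1) by (rule tangent_space_intros(2)[rotated])
    have e_span: "?e \<in> span (insert c C)"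
      by (rule span_diff[OF span_base]) (use d(1) mono in auto)
    let ?v = "v + (g p (x - v) ?e / g p ?e ?e) *\<^sub>R ?e"
    have vT: "?v \<in> T p" using T e by (auto intro!: tangent_space_intros)
    have "?v \<in> span (insert c C)" 
      by (rule span_add[OF _ span_scale[OF e_span]]) (use v(1) mono in blast)
    moreover have "\<forall>u\<in>span (insert c C). g p (x - ?v) u = 0"
    proof (rule orth)
      show "insert c C \<subseteq> T p" "x - ?v \<in> T p" using insert.prems vT by (auto intro!: tangent_space_intros)
      have xv: "x - v \<in> T p" using insert.prems T by (auto intro!: tangent_space_intros)
      have split: "g p (x - ?v) u = g p (x - v) u - g p (x - v) ?e / g p ?e ?e * g p ?e u" if "u \<in> T p" for u
        using g_diff_left[OF that xv tangent_space_intros(3)[OF e]] g_scale_left[OF that e]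
        by (simp add: diff_diff_eq[symmetric])
      have C: "g p (x - ?v) u = 0" if "u \<in> span C" for u
        using split[of u] v(2)[OF that] d(2)[OF that] span_sub[OF cC(2)] that by auto
      have "g p (x - ?v) ?e = 0"
        using split[OF e] g_eq_0[OF e] g_zero_right[OF xv] by (cases "g p ?e ?e = 0") auto
      then have "g p (x - ?v) c = 0"
        using g_add_right[of "x - ?v" p ?e d] C[OF d(1)] e T \<open>x - ?v \<in> T p\<close> by simp
      then show "g p (x - ?v) u = 0" if "u \<in> insert c C" for u
        using that C span_base by blast
    qed
    ultimately show ?case by blast
  qed
qed

text \<open>A frame spans the tangent space, so each of its subspaces is the span of a finite set.\<close>

lemma orth_decomposition:
  assumes "subspace S" "S \<subseteq> T p" "x \<in> T p"
  shows "\<exists>v\<in>S. \<forall>u\<in>S. g p (x - v) u = 0"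
proof -
  obtain \<rho> f E where fr: "frame_at A p \<rho> f E" by (rule frame_exists[OF manifold])
  have "T p \<subseteq> span ((\<lambda>i. E i p) ` Basis)"
  proof
    fix w assume "w \<in> T p"
    from frame_atD(8)[OF fr this] have "w = (\<Sum>i\<in>Basis. w (f i) *\<^sub>R E i p)" .
    also have "\<dots> \<in> span ((\<lambda>i. E i p) ` Basis)" by (intro span_sum span_scale span_base) auto
    finally show "w \<in> span ((\<lambda>i. E i p) ` Basis)" .
  qed
  moreover obtain C where C: "C \<subseteq> S" "independent C" "S \<subseteq> span C"
    using maximal_independent_subset[of S] by blast
  ultimately have "finite C"
    using independent_span_bound[of "(\<lambda>i. E i p) ` Basis" C] assms(2) by auto
  moreover have "span C = S" using C assms(1) by (simp add: span_subspace)
  ultimately show ?thesis using orth_span[of C p x] C(1) assms by blast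
qed

text \<open>The representing vector is a multiple of any vector orthogonal to the kernel of \<open>L\<close> but not
  in it, unless \<open>L = 0\<close>.\<close>

lemma riesz:
  assumes L: "\<And>u v. u \<in> T p \<Longrightarrow> v \<in> T p \<Longrightarrow> L (u + v) = L u + L v"
    "\<And>a u. u \<in> T p \<Longrightarrow> L (a *\<^sub>R u) = a * L u"
  shows "\<exists>v\<in>T p. \<forall>w\<in>T p. g p v w = L w"
proof (cases "\<forall>u\<in>T p. L u = 0")
  case True
  then show ?thesis by (intro bexI[of _ 0]) (auto simp: g_zero_left tangent_space_intros)
next
  case False
  then obtain x where x: "x \<in> T p" "L x \<noteq> 0" by blast
  let ?K = "{u \<in> T p. L u = 0}"
  have L0: "L 0 = 0" using L(2)[of 0 0] by (simp add: tangent_space_intros)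
  have "subspace ?K" by (auto simp: subspace_def L L0 intro!: tangent_space_intros)
  then obtain k where k: "k \<in> ?K" "\<And>u. u \<in> ?K \<Longrightarrow> g p (x - k) u = 0"
    using orth_decomposition[of ?K p x] x(1) by blast
  let ?n = "x - k"
  have n: "?n \<in> T p" using x k(1) by (auto intro!: tangent_space_intros)
  have Ln: "L ?n \<noteq> 0" using L(1)[of ?n k] n k(1) x(2) by simp
  then have "?n \<noteq> 0" using L0 by metis
  then have nn: "g p ?n ?n \<noteq> 0" using g_eq_0[OF n] by blast
  show ?thesis
  proof (intro bexI ballI)
    show "(L ?n / g p ?n ?n) *\<^sub>R ?n \<in> T p" using n by (rule tangent_space_intros)
    fix w assume w: "w \<in> T p"
    define a where "a = L w / L ?n"
    have aw: "w + (- a) *\<^sub>R ?n \<in> T p" using w n by (auto intro!: tangent_space_intros)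
    have "L (w + (- a) *\<^sub>R ?n) = 0"
      using L(1)[OF w tangent_space_intros(3)[OF n, of "- a"]] L(2)[OF n, of "- a"] Ln by (simp add: a_def)
    with aw k(2)[of "w + (- a) *\<^sub>R ?n"] have "g p ?n (w + (- a) *\<^sub>R ?n) = 0" by blast
    then have "g p ?n w = a * g p ?n ?n"
      using g_add_right[OF n w tangent_space_intros(3)[OF n, of "- a"]] g_scale_right[OF n n, of "- a"] by simp
    then show "g p ((L ?n / g p ?n ?n) *\<^sub>R ?n) w = L w"
      using g_scale_left[OF w n] nn Ln by (simp add: a_def)
  qed
qed

lemma gradient_properties:
  assumes "smooth_fun A f"
  shows "gradient A g f p \<in> T p" "w \<in> T p \<Longrightarrow> g p (gradient A g f p) w = w f"
proof -
  obtain v where v: "v \<in> T p" "\<And>w. w \<in> T p \<Longrightarrow> g p v w = w f"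
    using riesz[of p "\<lambda>w. w f"] by auto
  have "gradient A g f p = v"
    unfolding gradient_def
  proof (rule the_equality)
    show "v \<in> T p \<and> (\<forall>w\<in>T p. g p v w = w f)" using v by blast
    fix u assume u: "u \<in> T p \<and> (\<forall>w\<in>T p. g p u w = w f)"
    then have uv: "u - v \<in> T p" using v(1) by (auto intro!: tangent_space_intros)
    then have "g p (u - v) (u - v) = 0" using g_diff_left[OF uv] u v by simp
    then show "u = v" using g_eq_0[OF uv] by simp
  qed
  then show "gradient A g f p \<in> T p" "w \<in> T p \<Longrightarrow> g p (gradient A g f p) w = w f" using v by auto
qed

text \<open>The definite description in the horizontal projection has a value by
  \<open>orth_decomposition\<close>, and only one because a vector that is both vertical and horizontal is orthogonal to
  itself.\<close>

lemma hor_proj_decomposition: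
  assumes "subspace (vertical A B F p)" "E p \<in> T p"
  shows "hor_proj A g B F E p \<in> horizontal A g B F p" "E p - hor_proj A g B F E p \<in> vertical A B F p"
proof -
  have sub: "vertical A B F p \<subseteq> T p" unfolding vertical_def by blast
  obtain v where v: "v \<in> vertical A B F p" "\<And>u. u \<in> vertical A B F p \<Longrightarrow> g p (E p - v) u = 0"
    using orth_decomposition[OF assms(1) sub assms(2)] by blast
  have ex: "E p - v \<in> horizontal A g B F p \<and> E p - (E p - v) \<in> vertical A B F p"
    using v sub assms(2) by (auto simp: orth_complement_def intro!: tangent_space_intros)
  have "hor_proj A g B F E p = E p - v"
    unfolding hor_proj_def
  proof (rule the_equality)
    show "E p - v \<in> horizontal A g B F p \<and> E p - (E p - v) \<in> vertical A B F p" by (rule ex)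
  next
    fix w assume w: "w \<in> horizontal A g B F p \<and> E p - w \<in> vertical A B F p"
    let ?d = "w - (E p - v)"
    have "?d = v - (E p - w)" by simp
    then have dV: "?d \<in> vertical A B F p" using v(1) w subspace_diff[OF assms(1)] by metis
    then have "?d \<in> T p" using sub by blast
    moreover have "g p ?d ?d = 0"
      using g_diff_left[of ?d p w "E p - v"] w ex dV \<open>?d \<in> T p\<close> by (simp add: orth_complement_def)
    ultimately show "w = E p - v" using g_eq_0 by fastforce
  qed
  with ex show "hor_proj A g B F E p \<in> horizontal A g B F p" "E p - hor_proj A g B F E p \<in> vertical A B F p"
    by simp_all
qed

end

section \<open>Submersions: the vertical bundle\<close>

lemma pushforward_apply: "smooth_fun B f \<Longrightarrow> pushforward B F v f = v (f \<circ> F)"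
  by (simp add: pushforward_def)

lemma pushforward_add: "pushforward B F (u + v) = pushforward B F u + pushforward B F v"
  by (auto simp: pushforward_def)

lemma pushforward_scale: "pushforward B F (a *\<^sub>R v) = a *\<^sub>R pushforward B F v"
  by (auto simp: pushforward_def)

lemma pushforward_diff: "pushforward B F (u - v) = pushforward B F u - pushforward B F v"
  by (auto simp: pushforward_def)

lemma pushforward_0: "pushforward B F 0 = 0"
  by (auto simp: pushforward_def)

lemma subspace_vertical: "subspace (vertical A B F p)"
  by (rule subspaceI) (auto simp: vertical_def pushforward_add pushforward_scale pushforward_0
      intro!: tangent_space_intros)

locale smooth_submersion =
  fixes A :: "('m::{t2_space, second_countable_topology}, 'a::euclidean_space) chart set"
    and B :: "('n::{t2_space, second_countable_topology}, 'b::euclidean_space) chart set"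
    and F :: "'m \<Rightarrow> 'n"
  assumes dom: "smooth_manifold A" and cod: "smooth_manifold B" and sub: "submersion A B F"
begin

lemma smooth_pull: "smooth_fun B f \<Longrightarrow> smooth_fun A (f \<circ> F)"
  using smooth_fun_compose[OF dom cod] sub unfolding submersion_def by blast

lemma push_tangent: "v \<in> tangent_space A p \<Longrightarrow> pushforward B F v \<in> tangent_space B (F p)"
  using sub unfolding submersion_def by blast

lemma push_surj: "w \<in> tangent_space B (F p) \<Longrightarrow> \<exists>v\<in>tangent_space A p. pushforward B F v = w"
  using sub unfolding submersion_def by (metis image_iff)

text \<open>Suppose \<open>U\<close> and \<open>V\<close> kill the functions of \<open>J\<close> and extend \<open>u\<close> and \<open>v\<close>, where \<open>u\<close> is dual to
  a further function \<open>k j\<close>. Then \<open>U(k j) V - V(k j) U\<close> kills \<open>k j\<close> as well, and at \<open>p\<close> it equals \<open>v\<close>. This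
  elimination replaces the inversion of a matrix of smooth functions.\<close>

lemma killing_field:
  assumes "finite J" "\<And>i. i \<in> J \<Longrightarrow> smooth_fun A (k i)"
    and "\<And>j. j \<in> J \<Longrightarrow> \<exists>u\<in>tangent_space A p. \<forall>i\<in>J. u (k i) = (if i = j then 1 else 0)"
    and "v \<in> tangent_space A p" "\<And>i. i \<in> J \<Longrightarrow> v (k i) = 0"
  shows "\<exists>V\<in>vector_fields A. V p = v \<and> (\<forall>q. \<forall>i\<in>J. V q (k i) = 0)"
  using assms
proof (induction J arbitrary: v rule: finite_induct)
  case empty
  then show ?case using extend_tangent_vector[OF dom, of v p] by auto
next
  case (insert j J)
  have dual: "\<exists>u\<in>tangent_space A p. \<forall>i\<in>J. u (k i) = (if i = l then 1 else 0)" if "l \<in> J" for l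
    using insert.prems(2)[of l] that by (meson insertI2)
  obtain u where u: "u \<in> tangent_space A p" "u (k j) = 1" "\<And>i. i \<in> J \<Longrightarrow> u (k i) = 0"
    using insert.prems(2)[of j] insert.hyps(2) by (metis insertCI)
  obtain U where U: "U \<in> vector_fields A" "U p = u" "\<And>q i. i \<in> J \<Longrightarrow> U q (k i) = 0"
    using insert.IH[OF insert.prems(1)[OF insertI2] dual u(1,3)] by blast
  obtain V where V: "V \<in> vector_fields A" "V p = v" "\<And>q i. i \<in> J \<Longrightarrow> V q (k i) = 0"
    using insert.IH[OF insert.prems(1)[OF insertI2] dual insert.prems(3) insert.prems(4)[OF insertI2]] by blast
  have kj: "smooth_fun A (k j)" using insert.prems(1) by blast
  let ?W = "\<lambda>q. U q (k j) *\<^sub>R V q - V q (k j) *\<^sub>R U q"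
  have "?W \<in> vector_fields A"
    by (rule vector_field_diff[OF dom vector_field_scale[OF dom vector_field_smooth[OF U(1) kj] V(1)]
          vector_field_scale[OF dom vector_field_smooth[OF V(1) kj] U(1)]])
  moreover have "?W p = v" using U(2) V(2) u(2) insert.prems(4) by simp
  moreover have "\<forall>q. \<forall>i\<in>insert j J. ?W q (k i) = 0" using U(3) V(3) by auto
  ultimately show ?case by (intro bexI[of _ ?W]) simp_all
qed

text \<open>A field that kills the pulled back coordinate functions of a frame of the base is vertical where
  the frame is one; the factor \<open>\<rho> \<circ> F\<close> makes it vertical everywhere.\<close>

theorem extend_vertical_vector:
  assumes v: "v \<in> vertical A B F p"
  obtains V where "V \<in> sections_of A (vertical A B F)" "V p = v"
proof -
  obtain \<rho> h H where fr: "frame_at B (F p) \<rho> h H" by (rule frame_exists[OF cod])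
  note fr = frame_atD[OF fr]
  let ?k = "\<lambda>i. h i \<circ> F"
  have "\<exists>V\<in>vector_fields A. V p = v \<and> (\<forall>q. \<forall>i\<in>Basis. V q (?k i) = 0)"
  proof (rule killing_field)
    fix j :: 'b assume j: "j \<in> Basis"
    obtain u where u: "u \<in> tangent_space A p" "pushforward B F u = H j (F p)"
      using push_surj[OF vector_field_tangent[OF fr(5)[OF j]]] by blast
    have "u (?k i) = (if i = j then 1 else 0)" if "i \<in> Basis" for i
      using pushforward_apply[OF fr(4)[OF that], of F u] fr(6)[OF j that, of "F p"] u(2) fr(2) by auto
    then show "\<exists>u\<in>tangent_space A p. \<forall>i\<in>Basis. u (?k i) = (if i = j then 1 else 0)" using u(1) by blast
  next
    fix i :: 'b assume i: "i \<in> Basis"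
    show "v (?k i) = 0" using v pushforward_apply[OF fr(4)[OF i], of F v] by (simp add: vertical_def)
  qed (use v fr(4) smooth_pull in \<open>auto simp: vertical_def\<close>)
  then obtain V where V: "V \<in> vector_fields A" "V p = v" "\<And>q i. i \<in> Basis \<Longrightarrow> V q (?k i) = 0" by blast
  let ?W = "\<lambda>q. (\<rho> \<circ> F) q *\<^sub>R V q"
  have W: "?W \<in> vector_fields A" by (rule vector_field_scale[OF dom smooth_pull[OF fr(1)] V(1)])
  have "pushforward B F (?W q) = 0" for q
  proof -
    have "\<rho> (F q) *\<^sub>R pushforward B F (V q) = (\<Sum>i\<in>Basis. pushforward B F (V q) (h i) *\<^sub>R H i (F q))"
      by (rule fr(7)[OF push_tangent[OF vector_field_tangent[OF V(1)]]])
    also have "\<dots> = 0" using V(3) by (simp add: pushforward_apply fr(4))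
    finally show ?thesis by (simp add: pushforward_scale)
  qed
  then have "?W \<in> sections_of A (vertical A B F)"
    using W vector_field_tangent[OF W] by (simp add: sections_of_def vertical_def)
  then show ?thesis by (rule that) (simp add: V(2) fr(2))
qed

end

section \<open>Affine connections\<close>

lemma affine_connectionD:
  assumes "affine_connection A D"
  shows "\<And>X Y. X \<in> vector_fields A \<Longrightarrow> Y \<in> vector_fields A \<Longrightarrow> D X Y \<in> vector_fields A"
    "\<And>X X' Y. X \<in> vector_fields A \<Longrightarrow> X' \<in> vector_fields A \<Longrightarrow> Y \<in> vector_fields A \<Longrightarrow>
       D (X + X') Y = D X Y + D X' Y"
    "\<And>f X Y. smooth_fun A f \<Longrightarrow> X \<in> vector_fields A \<Longrightarrow> Y \<in> vector_fields A \<Longrightarrow>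
       D (\<lambda>p. f p *\<^sub>R X p) Y = (\<lambda>p. f p *\<^sub>R D X Y p)"
    "\<And>X Y Y'. X \<in> vector_fields A \<Longrightarrow> Y \<in> vector_fields A \<Longrightarrow> Y' \<in> vector_fields A \<Longrightarrow>
       D X (Y + Y') = D X Y + D X Y'"
  using assms unfolding affine_connection_def by (elim conjE, blast)+

lemma levi_civitaD:
  assumes "levi_civita A g D"
  shows "affine_connection A D"
    "\<And>X Y. X \<in> vector_fields A \<Longrightarrow> Y \<in> vector_fields A \<Longrightarrow> D X Y - D Y X = lie_bracket X Y"
    "\<And>X Y Z p. X \<in> vector_fields A \<Longrightarrow> Y \<in> vector_fields A \<Longrightarrow> Z \<in> vector_fields A \<Longrightarrow>
       X p (\<lambda>q. g q (Y q) (Z q)) = g p (D X Y p) (Z p) + g p (Y p) (D X Z p)"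
  using assms unfolding levi_civita_def by blast+

lemma affine_connection_zero_right:
  assumes "smooth_manifold A" "affine_connection A D" "X \<in> vector_fields A"
  shows "D X 0 = 0"
  using affine_connectionD(4)[OF assms(2,3) vector_field_0[OF assms(1)] vector_field_0[OF assms(1)]] by simp

lemma affine_connection_zero_left:
  assumes "smooth_manifold A" "affine_connection A D" "Y \<in> vector_fields A"
  shows "D 0 Y = 0"
  using affine_connectionD(2)[OF assms(2) vector_field_0[OF assms(1)] vector_field_0[OF assms(1)] assms(3)] by simp

lemma affine_connection_sum_left:
  fixes A :: "('m::{t2_space, second_countable_topology}, 'e::euclidean_space) chart set"
  assumes A: "smooth_manifold A" and D: "affine_connection A D"
    and X: "\<And>i::'i. i \<in> I \<Longrightarrow> X i \<in> vector_fields A" and Y: "Y \<in> vector_fields A"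
  shows "D (\<lambda>p. \<Sum>i\<in>I. (a i :: real) *\<^sub>R X i p) Y = (\<lambda>p. \<Sum>i\<in>I. a i *\<^sub>R D (X i) Y p)"
  using X
proof (induction I rule: infinite_finite_induct)
  case (insert j I)
  have aX: "(\<lambda>p. a i *\<^sub>R X i p) \<in> vector_fields A" if "i \<in> insert j I" for i
    using vector_field_scale[OF A smooth_fun_const[OF A] insert.prems[OF that]] .
  have S: "(\<lambda>p. \<Sum>i\<in>I. a i *\<^sub>R X i p) \<in> vector_fields A"
    by (rule vector_field_sum[OF A aX]) simp
  have split: "(\<lambda>p. \<Sum>i\<in>insert j I. a i *\<^sub>R Z i p) = (\<lambda>p. a j *\<^sub>R Z j p) + (\<lambda>p. \<Sum>i\<in>I. a i *\<^sub>R Z i p)"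
    for Z :: "'i \<Rightarrow> 'm vfield"
    by (rule ext) (use insert.hyps in simp)
  have "D (\<lambda>p. \<Sum>i\<in>insert j I. a i *\<^sub>R X i p) Y
      = D (\<lambda>p. a j *\<^sub>R X j p) Y + D (\<lambda>p. \<Sum>i\<in>I. a i *\<^sub>R X i p) Y"
    unfolding split by (rule affine_connectionD(2)[OF D aX[of j] S Y]) simp
  also have "D (\<lambda>p. a j *\<^sub>R X j p) Y = (\<lambda>p. a j *\<^sub>R D (X j) Y p)"
    by (rule affine_connectionD(3)[OF D smooth_fun_const[OF A] insert.prems Y]) simp
  also have "D (\<lambda>p. \<Sum>i\<in>I. a i *\<^sub>R X i p) Y = (\<lambda>p. \<Sum>i\<in>I. a i *\<^sub>R D (X i) Y p)"
    by (rule insert.IH) (use insert.prems in blast)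
  finally show ?case unfolding split .
qed (use affine_connection_zero_left[OF A D Y] in \<open>simp_all add: zero_fun_def\<close>)

section \<open>The pullback connection is torsion free and metric\<close>

locale pullback = smooth_submersion A B F + N: riemannian B h
  for A :: "('m::{t2_space, second_countable_topology}, 'a::euclidean_space) chart set"
    and B :: "('n::{t2_space, second_countable_topology}, 'b::euclidean_space) chart set"
    and F :: "'m \<Rightarrow> 'n" and h :: "'n \<Rightarrow> 'n tvec \<Rightarrow> 'n tvec \<Rightarrow> real" +
  fixes DN :: "'n vfield \<Rightarrow> 'n vfield \<Rightarrow> 'n vfield"
    and DF :: "'m vfield \<Rightarrow> ('m \<Rightarrow> 'n tvec) \<Rightarrow> ('m \<Rightarrow> 'n tvec)"
  assumes levi_civita: "levi_civita B h DN" and pullback: "pullback_connection A B F DN DF"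
begin

abbreviation push :: "'m tvec \<Rightarrow> 'n tvec" where "push \<equiv> pushforward B F"

lemma DF_fields: "X \<in> vector_fields A \<Longrightarrow> W \<in> fields_along A B F \<Longrightarrow> DF X W \<in> fields_along A B F"
  using pullback unfolding pullback_connection_def by (elim conjE) blast

lemma DF_add: "X \<in> vector_fields A \<Longrightarrow> W \<in> fields_along A B F \<Longrightarrow> W' \<in> fields_along A B F \<Longrightarrow>
    DF X (W + W') = DF X W + DF X W'"
  using pullback unfolding pullback_connection_def by (elim conjE) blast

lemma DF_leibniz: "smooth_fun A f \<Longrightarrow> X \<in> vector_fields A \<Longrightarrow> W \<in> fields_along A B F \<Longrightarrow>
    DF X (\<lambda>p. f p *\<^sub>R W p) = (\<lambda>p. X p f *\<^sub>R W p + f p *\<^sub>R DF X W p)"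
  using pullback unfolding pullback_connection_def by (elim conjE) blast

lemma DF_compose: "X \<in> vector_fields A \<Longrightarrow> Y \<in> vector_fields B \<Longrightarrow> Z \<in> vector_fields B \<Longrightarrow>
    Z (F p) = push (X p) \<Longrightarrow> DF X (Y \<circ> F) p = DN Z Y (F p)"
  using pullback unfolding pullback_connection_def by (elim conjE) blast

lemma fields_alongD:
  assumes "W \<in> fields_along A B F"
  shows "W p \<in> tangent_space B (F p)" "smooth_fun B f \<Longrightarrow> smooth_fun A (\<lambda>p. W p f)"
  using assms unfolding fields_along_def by blast+

lemma fields_along_0: "0 \<in> fields_along A B F"
  unfolding fields_along_def by (auto intro: tangent_space_intros smooth_fun_const dom)

lemma fields_along_scale:
  "smooth_fun A f \<Longrightarrow> W \<in> fields_along A B F \<Longrightarrow> (\<lambda>p. f p *\<^sub>R W p) \<in> fields_along A B F"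
  unfolding fields_along_def by (auto intro!: tangent_space_intros smooth_fun_mult dom)

lemma fields_along_sum:
  "(\<And>i. i \<in> I \<Longrightarrow> W i \<in> fields_along A B F) \<Longrightarrow> (\<lambda>p. \<Sum>i\<in>I. W i p) \<in> fields_along A B F"
  unfolding fields_along_def by (auto intro!: tangent_space_intros smooth_fun_sum dom simp: sum_fun_apply)

lemma fields_along_compose: "Y \<in> vector_fields B \<Longrightarrow> Y \<circ> F \<in> fields_along A B F"
  unfolding fields_along_def vector_fields_def
  using smooth_pull by (fastforce simp: o_def)

lemma fields_along_push:
  assumes "Y \<in> vector_fields A"
  shows "(\<lambda>p. push (Y p)) \<in> fields_along A B F"
  using vector_field_tangent[OF assms] vector_field_smooth[OF assms] push_tangent smooth_pull
  unfolding fields_along_def by (auto simp: pushforward_apply)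

lemma DF_0: "X \<in> vector_fields A \<Longrightarrow> DF X 0 = 0"
  using DF_add[OF _ fields_along_0 fields_along_0] by simp

lemma DF_sum:
  assumes X: "X \<in> vector_fields A" and W: "\<And>i. i \<in> I \<Longrightarrow> W i \<in> fields_along A B F"
  shows "DF X (\<lambda>p. \<Sum>i\<in>I. W i p) = (\<lambda>p. \<Sum>i\<in>I. DF X (W i) p)"
  using W
proof (induction I rule: infinite_finite_induct)
  case (insert j I)
  have "(\<lambda>p. \<Sum>i\<in>I. W i p) \<in> fields_along A B F" using insert.prems by (intro fields_along_sum) blast
  moreover have "(\<lambda>p. \<Sum>i\<in>insert j I. W i p) = W j + (\<lambda>p. \<Sum>i\<in>I. W i p)"
    using insert.hyps by (simp add: plus_fun_def)
  ultimately show ?case using DF_add[OF X insert.prems[of j]] insert by (simp add: plus_fun_def)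
qed (use DF_0[OF X] in \<open>simp_all add: zero_fun_def\<close>)

context
  fixes p \<rho> k H
  assumes fr: "frame_at B (F p) \<rho> k H"
begin

lemmas frame = frame_atD[OF fr]

text \<open>The push of \<open>X p\<close> is the value of a combination \<open>Z\<close> of the frame fields with constant
  coefficients, so \<open>DN Z\<close> can be evaluated by linearity.\<close>

lemma DF_frame:
  assumes X: "X \<in> vector_fields A" and i: "i \<in> Basis"
  shows "DF X (H i \<circ> F) p = (\<Sum>j\<in>Basis. push (X p) (k j) *\<^sub>R DN (H j) (H i) (F p))"
proof -
  let ?Z = "\<lambda>r. \<Sum>j\<in>Basis. push (X p) (k j) *\<^sub>R H j r"
  have Z: "?Z \<in> vector_fields B"
    by (intro vector_field_sum cod vector_field_scale[OF cod smooth_fun_const[OF cod]] frame(5))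
  have "?Z (F p) = push (X p)"
    using frame(8)[OF push_tangent[OF vector_field_tangent[OF X]]] by simp
  then have "DF X (H i \<circ> F) p = DN ?Z (H i) (F p)" by (rule DF_compose[OF X frame(5)[OF i] Z])
  also have "\<dots> = (\<Sum>j\<in>Basis. push (X p) (k j) *\<^sub>R DN (H j) (H i) (F p))"
    by (rule fun_cong[OF affine_connection_sum_left[OF cod levi_civitaD(1)[OF levi_civita] frame(5) frame(5)[OF i]]])
  finally show ?thesis .
qed

text \<open>This is where the pullback connection becomes local: both sides arise by differentiating the
  global identity \<open>(\<rho> \<circ> F) W = \<Sum> W(k i) (H i \<circ> F)\<close>, and at \<open>p\<close> the factor \<open>\<rho> \<circ> F\<close> is invisible.\<close>

lemma DF_expand:
  assumes X: "X \<in> vector_fields A" and W: "W \<in> fields_along A B F"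
  shows "DF X W p = (\<Sum>i\<in>Basis. X p (\<lambda>q. W q (k i)) *\<^sub>R H i (F p) + W p (k i) *\<^sub>R DF X (H i \<circ> F) p)"
proof -
  have HF: "H i \<circ> F \<in> fields_along A B F" if "i \<in> Basis" for i
    using that by (intro fields_along_compose frame(5))
  have Wk: "smooth_fun A (\<lambda>q. W q (k i))" if "i \<in> Basis" for i
    using that by (intro fields_alongD[OF W] frame(4))
  have "(\<lambda>q. (\<rho> \<circ> F) q *\<^sub>R W q) = (\<lambda>q. \<Sum>i\<in>Basis. W q (k i) *\<^sub>R (H i \<circ> F) q)"
    using frame(7)[OF fields_alongD(1)[OF W]] by (simp add: fun_eq_iff)
  then have "DF X (\<lambda>q. (\<rho> \<circ> F) q *\<^sub>R W q) p = DF X (\<lambda>q. \<Sum>i\<in>Basis. W q (k i) *\<^sub>R (H i \<circ> F) q) p"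
    by (simp only:)
  also have "\<dots> = (\<Sum>i\<in>Basis. DF X (\<lambda>q. W q (k i) *\<^sub>R (H i \<circ> F) q) p)"
    by (rule fun_cong[OF DF_sum[OF X fields_along_scale[OF Wk HF]]])
  also have "\<dots> = (\<Sum>i\<in>Basis. X p (\<lambda>q. W q (k i)) *\<^sub>R H i (F p) + W p (k i) *\<^sub>R DF X (H i \<circ> F) p)"
  proof (rule sum.cong[OF refl])
    fix i :: 'b assume i: "i \<in> Basis"
    show "DF X (\<lambda>q. W q (k i) *\<^sub>R (H i \<circ> F) q) p
        = X p (\<lambda>q. W q (k i)) *\<^sub>R H i (F p) + W p (k i) *\<^sub>R DF X (H i \<circ> F) p"
      using fun_cong[OF DF_leibniz[OF Wk[OF i] X HF[OF i]], of p] by (simp only: o_apply)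
  qed
  also have "DF X (\<lambda>q. (\<rho> \<circ> F) q *\<^sub>R W q) p = DF X W p"
  proof -
    have "X p (\<rho> \<circ> F) = 0"
      using frame(3)[OF push_tangent[OF vector_field_tangent[OF X]]] by (simp add: pushforward_apply frame(1))
    then show ?thesis using DF_leibniz[OF smooth_pull[OF frame(1)] X W] frame(2) by simp
  qed
  finally show ?thesis .
qed

text \<open>The fields of the frame commute at the base point: their bracket there is determined by its values
  on the \<open>k l\<close>, and \<open>H j (k l)\<close> is a constant multiple of \<open>\<rho>\<close>, whose differential vanishes there.\<close>

lemma frame_commute:
  assumes i: "i \<in> Basis" and j: "j \<in> Basis"
  shows "DN (H i) (H j) (F p) = DN (H j) (H i) (F p)"
proof -
  note LC = levi_civitaD[OF levi_civita] and AC = affine_connectionD[OF levi_civitaD(1)[OF levi_civita]]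
  have br: "lie_bracket (H i) (H j) = DN (H i) (H j) - DN (H j) (H i)"
    using LC(2)[OF frame(5)[OF i] frame(5)[OF j]] by simp
  have "lie_bracket (H i) (H j) (F p) \<in> tangent_space B (F p)"
    unfolding br using vector_field_tangent[OF AC(1)[OF frame(5)[OF i] frame(5)[OF j]]]
      vector_field_tangent[OF AC(1)[OF frame(5)[OF j] frame(5)[OF i]]]
    by (auto intro!: tangent_space_intros)
  from frame(8)[OF this]
  have "lie_bracket (H i) (H j) (F p) = (\<Sum>l\<in>Basis. lie_bracket (H i) (H j) (F p) (k l) *\<^sub>R H l (F p))" .
  also have "\<dots> = 0"
  proof (rule sum.neutral, rule)
    fix l :: 'b assume l: "l \<in> Basis"
    have z: "H m (F p) (\<lambda>q. H n q (k l)) = 0" if "m \<in> Basis" "n \<in> Basis" for m n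
    proof -
      have t: "H m (F p) \<in> tangent_space B (F p)" by (rule vector_field_tangent[OF frame(5)[OF that(1)]])
      have "(\<lambda>q. H n q (k l)) = (\<lambda>q. (if n = l then 1 else 0) * \<rho> q)"
        using frame(6)[OF that(2) l] by (simp add: mult.commute)
      then show ?thesis using tangent_cmult[OF t frame(1)] frame(3)[OF t] by simp
    qed
    show "lie_bracket (H i) (H j) (F p) (k l) *\<^sub>R H l (F p) = 0"
      using z[OF i j] z[OF j i] by (simp add: lie_bracket_def)
  qed
  finally show ?thesis unfolding br by simp
qed

end

text \<open>In a frame, the two covariant derivatives differ by the bracket of \<open>X\<close> and \<open>Y\<close> applied to the
  coordinate functions, plus a double sum that cancels because the connection coefficients of a commuting
  frame are symmetric.\<close>

theorem DF_torsion_free: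
  assumes X: "X \<in> vector_fields A" and Y: "Y \<in> vector_fields A"
    and br: "lie_bracket X Y p \<in> tangent_space A p"
  shows "DF X (\<lambda>q. push (Y q)) p - DF Y (\<lambda>q. push (X q)) p = push (lie_bracket X Y p)"
proof -
  obtain \<rho> k H where fr: "frame_at B (F p) \<rho> k H" by (rule frame_exists[OF cod])
  note frame = frame_atD[OF fr]
  have ex: "DF X (\<lambda>q. push (Y q)) p = (\<Sum>i\<in>Basis. X p (\<lambda>q. push (Y q) (k i)) *\<^sub>R H i (F p))
      + (\<Sum>i\<in>Basis. \<Sum>j\<in>Basis. (push (Y p) (k i) * push (X p) (k j)) *\<^sub>R DN (H j) (H i) (F p))"
    if X: "X \<in> vector_fields A" and Y: "Y \<in> vector_fields A" for X Y
    by (simp add: DF_expand[OF fr X fields_along_push[OF Y]] DF_frame[OF fr X] sum.distrib scaleR_sum_right)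
  have "(\<Sum>i\<in>Basis. \<Sum>j\<in>Basis. (push (Y p) (k i) * push (X p) (k j)) *\<^sub>R DN (H j) (H i) (F p))
      = (\<Sum>i\<in>Basis. \<Sum>j\<in>Basis. (push (X p) (k i) * push (Y p) (k j)) *\<^sub>R DN (H j) (H i) (F p))"
    by (subst sum.swap) (auto intro!: sum.cong simp: frame_commute[OF fr] mult.commute)
  then have "DF X (\<lambda>q. push (Y q)) p - DF Y (\<lambda>q. push (X q)) p
      = (\<Sum>i\<in>Basis. (X p (\<lambda>q. push (Y q) (k i)) - Y p (\<lambda>q. push (X q) (k i))) *\<^sub>R H i (F p))"
    by (simp add: ex[OF X Y] ex[OF Y X] sum_subtractf scaleR_diff_left)
  also have "\<dots> = (\<Sum>i\<in>Basis. push (lie_bracket X Y p) (k i) *\<^sub>R H i (F p))"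
    by (rule sum.cong[OF refl]) (simp add: pushforward_apply frame(4) lie_bracket_def)
  also have "\<dots> = push (lie_bracket X Y p)" using frame(8)[OF push_tangent[OF br]] by simp
  finally show ?thesis .
qed

text \<open>For pullbacks of frame fields this is metricity of \<open>DN\<close> (the step \<open>X\<gamma>\<close>); the general
  case follows by the Leibniz rule from the expansion of both sections in the frame. The hypothesis
  \<open>G\<close> ensures that \<open>X p\<close> differentiates \<open>h(V, W)\<close>, instead of returning the default value \<open>0\<close> for functions
  that are not smooth.\<close>

theorem DF_metric:
  assumes X: "X \<in> vector_fields A" and V: "V \<in> fields_along A B F" and W: "W \<in> fields_along A B F"
    and G: "smooth_fun A (\<lambda>q. h (F q) (V q) (W q))"
  shows "X p (\<lambda>q. h (F q) (V q) (W q)) = h (F p) (DF X V p) (W p) + h (F p) (V p) (DF X W p)"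
proof -
  obtain \<rho> k H where fr: "frame_at B (F p) \<rho> k H" by (rule frame_exists[OF cod])
  note frame = frame_atD[OF fr]
  define \<sigma> where "\<sigma> = \<rho> \<circ> F"
  define \<gamma> where "\<gamma> = (\<lambda>i j r. h r (H i r) (H j r))"
  define v where "v = (\<lambda>i q. V q (k i))"
  define w where "w = (\<lambda>i q. W q (k i))"
  have t: "X p \<in> tangent_space A p" by (rule vector_field_tangent[OF X])
  have s\<sigma>: "smooth_fun A \<sigma>" unfolding \<sigma>_def by (rule smooth_pull[OF frame(1)])
  have s\<sigma>\<sigma>: "smooth_fun A (\<lambda>q. \<sigma> q * \<sigma> q)" by (rule smooth_fun_mult[OF dom s\<sigma> s\<sigma>])
  have \<sigma>: "\<sigma> p = 1" "X p \<sigma> = 0"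
    using frame(2) frame(3)[OF push_tangent[OF t]] by (simp_all add: pushforward_apply frame(1) \<sigma>_def)
  have s\<gamma>: "smooth_fun B (\<gamma> i j)" if "i \<in> Basis" "j \<in> Basis" for i j
    unfolding \<gamma>_def by (rule N.g_smooth[OF frame(5)[OF that(1)] frame(5)[OF that(2)]])
  have sv: "smooth_fun A (v i)" and sw: "smooth_fun A (w i)" if "i \<in> Basis" for i
    unfolding v_def w_def using fields_alongD(2)[OF V frame(4)[OF that]] fields_alongD(2)[OF W frame(4)[OF that]] .
  have HT: "H i r \<in> tangent_space B r" if "i \<in> Basis" for i r by (rule vector_field_tangent[OF frame(5)[OF that]])
  have DT: "DF X (H i \<circ> F) p \<in> tangent_space B (F p)" if "i \<in> Basis" for i
    by (rule fields_alongD(1)[OF DF_fields[OF X fields_along_compose[OF frame(5)[OF that]]]])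
  have vT: "V q \<in> tangent_space B (F q)" and wT: "W q \<in> tangent_space B (F q)" for q
    using fields_alongD(1)[OF V] fields_alongD(1)[OF W] .
  have vp: "V p = (\<Sum>i\<in>Basis. v i p *\<^sub>R H i (F p))" and wp: "W p = (\<Sum>i\<in>Basis. w i p *\<^sub>R H i (F p))"
    unfolding v_def w_def using frame(8)[OF vT] frame(8)[OF wT] .
  have X\<gamma>: "X p (\<gamma> i j \<circ> F) = h (F p) (DF X (H i \<circ> F) p) (H j (F p)) + h (F p) (H i (F p)) (DF X (H j \<circ> F) p)"
    if ij: "i \<in> Basis" "j \<in> Basis" for i j
  proof -
    obtain Z where Z: "Z \<in> vector_fields B" "Z (F p) = push (X p)"
      by (rule extend_tangent_vector[OF cod push_tangent[OF t]])
    have "X p (\<gamma> i j \<circ> F) = Z (F p) (\<gamma> i j)" by (simp add: Z(2) pushforward_apply s\<gamma>[OF ij])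
    also have "\<dots> = h (F p) (DN Z (H i) (F p)) (H j (F p)) + h (F p) (H i (F p)) (DN Z (H j) (F p))"
      unfolding \<gamma>_def by (rule levi_civitaD(3)[OF levi_civita Z(1) frame(5)[OF ij(1)] frame(5)[OF ij(2)]])
    finally show ?thesis
      by (simp add: DF_compose[OF X frame(5)[OF ij(1)] Z] DF_compose[OF X frame(5)[OF ij(2)] Z])
  qed
  have expand_V: "DF X V p = (\<Sum>i\<in>Basis. X p (v i) *\<^sub>R H i (F p)) + (\<Sum>i\<in>Basis. v i p *\<^sub>R DF X (H i \<circ> F) p)"
    unfolding v_def sum.distrib[symmetric] by (rule DF_expand[OF fr X V])
  have expand_W: "DF X W p = (\<Sum>i\<in>Basis. X p (w i) *\<^sub>R H i (F p)) + (\<Sum>i\<in>Basis. w i p *\<^sub>R DF X (H i \<circ> F) p)"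
    unfolding w_def sum.distrib[symmetric] by (rule DF_expand[OF fr X W])
  have local: "(\<sigma> q * \<sigma> q) * h (F q) (V q) (W q) = (\<Sum>i\<in>Basis. \<Sum>j\<in>Basis. v i q * w j q * (\<gamma> i j \<circ> F) q)" for q
  proof -
    have "(\<sigma> q * \<sigma> q) * h (F q) (V q) (W q) = h (F q) (\<sigma> q *\<^sub>R V q) (\<sigma> q *\<^sub>R W q)"
      using vT[of q] wT[of q] by (simp add: N.g_scale_left N.g_scale_right tangent_space_intros)
    also have "\<dots> = h (F q) (\<Sum>i\<in>Basis. v i q *\<^sub>R H i (F q)) (\<Sum>j\<in>Basis. w j q *\<^sub>R H j (F q))"
      using frame(7)[OF vT] frame(7)[OF wT] by (simp add: \<sigma>_def v_def w_def)
    also have "\<dots> = (\<Sum>i\<in>Basis. v i q * h (F q) (H i (F q)) (\<Sum>j\<in>Basis. w j q *\<^sub>R H j (F q)))"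
      by (rule N.g_sum_left) (auto intro!: tangent_space_intros HT)
    also have "\<dots> = (\<Sum>i\<in>Basis. \<Sum>j\<in>Basis. v i q * w j q * (\<gamma> i j \<circ> F) q)"
      by (rule sum.cong[OF refl])
        (simp add: N.g_sum_right HT \<gamma>_def sum_distrib_left mult.assoc)
    finally show ?thesis .
  qed
  have "X p (\<lambda>q. (\<sigma> q * \<sigma> q) * h (F q) (V q) (W q)) = X p (\<lambda>q. h (F q) (V q) (W q))"
    using tangent_mult[OF t s\<sigma>\<sigma> G] tangent_mult[OF t s\<sigma> s\<sigma>] \<sigma> by simp
  then have "X p (\<lambda>q. h (F q) (V q) (W q))
      = X p (\<lambda>q. \<Sum>i\<in>Basis. \<Sum>j\<in>Basis. v i q * w j q * (\<gamma> i j \<circ> F) q)"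
    unfolding local by (rule sym)
  also have "\<dots> = (\<Sum>i\<in>Basis. \<Sum>j\<in>Basis. X p (\<lambda>q. v i q * w j q * (\<gamma> i j \<circ> F) q))"
  proof -
    have *: "smooth_fun A (\<lambda>q. v i q * w j q * (\<gamma> i j \<circ> F) q)" if "i \<in> Basis" "j \<in> Basis" for i j
      by (rule smooth_fun_mult[OF dom smooth_fun_mult[OF dom sv sw] smooth_pull[OF s\<gamma>]]) (use that in auto)
    show ?thesis
      by (subst tangent_sum[OF dom t smooth_fun_sum[OF dom *]], assumption, assumption)
        (rule sum.cong[OF refl], rule tangent_sum[OF dom t *])
  qed
  also have "\<dots> = (\<Sum>i\<in>Basis. \<Sum>j\<in>Basis.
        (X p (v i) * h (F p) (H i (F p)) (H j (F p)) + v i p * h (F p) (DF X (H i \<circ> F) p) (H j (F p))) * w j p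
      + v i p * (X p (w j) * h (F p) (H i (F p)) (H j (F p)) + w j p * h (F p) (H i (F p)) (DF X (H j \<circ> F) p)))"
  proof (intro sum.cong refl)
    fix i j :: 'b assume ij: "i \<in> Basis" "j \<in> Basis"
    show "X p (\<lambda>q. v i q * w j q * (\<gamma> i j \<circ> F) q) =
       (X p (v i) * h (F p) (H i (F p)) (H j (F p)) + v i p * h (F p) (DF X (H i \<circ> F) p) (H j (F p))) * w j p
      + v i p * (X p (w j) * h (F p) (H i (F p)) (H j (F p)) + w j p * h (F p) (H i (F p)) (DF X (H j \<circ> F) p))"
      using tangent_mult[OF t smooth_fun_mult[OF dom sv[OF ij(1)] sw[OF ij(2)]] smooth_pull[OF s\<gamma>[OF ij]]]
        tangent_mult[OF t sv[OF ij(1)] sw[OF ij(2)]] X\<gamma>[OF ij]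
      by (simp add: \<gamma>_def algebra_simps)
  qed
  also have "\<dots> = (\<Sum>i\<in>Basis. \<Sum>j\<in>Basis.
        (X p (v i) * h (F p) (H i (F p)) (H j (F p)) + v i p * h (F p) (DF X (H i \<circ> F) p) (H j (F p))) * w j p)
      + (\<Sum>i\<in>Basis. \<Sum>j\<in>Basis.
        v i p * (X p (w j) * h (F p) (H i (F p)) (H j (F p)) + w j p * h (F p) (H i (F p)) (DF X (H j \<circ> F) p)))"
    by (simp add: sum.distrib)
  also have "(\<Sum>i\<in>Basis. \<Sum>j\<in>Basis.
        (X p (v i) * h (F p) (H i (F p)) (H j (F p)) + v i p * h (F p) (DF X (H i \<circ> F) p) (H j (F p))) * w j p)
      = h (F p) (DF X V p) (W p)"
  proof -
    have "h (F p) (DF X V p) (W p) = (\<Sum>j\<in>Basis. w j p * h (F p) (DF X V p) (H j (F p)))"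
      unfolding wp by (rule N.g_sum_right[OF fields_alongD(1)[OF DF_fields[OF X V]] HT])
    also have "\<dots> = (\<Sum>j\<in>Basis. \<Sum>i\<in>Basis. w j p *
        (X p (v i) * h (F p) (H i (F p)) (H j (F p)) + v i p * h (F p) (DF X (H i \<circ> F) p) (H j (F p))))"
    proof (rule sum.cong[OF refl])
      fix j :: 'b assume j: "j \<in> Basis"
      have "h (F p) (DF X V p) (H j (F p)) = h (F p) (\<Sum>i\<in>Basis. X p (v i) *\<^sub>R H i (F p)) (H j (F p))
          + h (F p) (\<Sum>i\<in>Basis. v i p *\<^sub>R DF X (H i \<circ> F) p) (H j (F p))"
        unfolding expand_V
        by (rule N.g_add_left) (auto intro!: tangent_space_intros HT DT j)
      also have "\<dots> = (\<Sum>i\<in>Basis.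
          X p (v i) * h (F p) (H i (F p)) (H j (F p)) + v i p * h (F p) (DF X (H i \<circ> F) p) (H j (F p)))"
        by (simp add: N.g_sum_left[OF HT[OF j] HT] N.g_sum_left[OF HT[OF j] DT] sum.distrib)
      finally show "w j p * h (F p) (DF X V p) (H j (F p)) = (\<Sum>i\<in>Basis. w j p *
        (X p (v i) * h (F p) (H i (F p)) (H j (F p)) + v i p * h (F p) (DF X (H i \<circ> F) p) (H j (F p))))"
        by (simp add: sum_distrib_left)
    qed
    finally show ?thesis by (subst sum.swap) (simp add: mult.commute)
  qed
  also have "(\<Sum>i\<in>Basis. \<Sum>j\<in>Basis.
        v i p * (X p (w j) * h (F p) (H i (F p)) (H j (F p)) + w j p * h (F p) (H i (F p)) (DF X (H j \<circ> F) p)))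
      = h (F p) (V p) (DF X W p)"
  proof -
    have "h (F p) (V p) (DF X W p) = (\<Sum>i\<in>Basis. v i p * h (F p) (H i (F p)) (DF X W p))"
      unfolding vp by (rule N.g_sum_left[OF fields_alongD(1)[OF DF_fields[OF X W]] HT])
    also have "\<dots> = (\<Sum>i\<in>Basis. \<Sum>j\<in>Basis. v i p *
        (X p (w j) * h (F p) (H i (F p)) (H j (F p)) + w j p * h (F p) (H i (F p)) (DF X (H j \<circ> F) p)))"
    proof (rule sum.cong[OF refl])
      fix i :: 'b assume i: "i \<in> Basis"
      have "h (F p) (H i (F p)) (DF X W p) = h (F p) (H i (F p)) (\<Sum>j\<in>Basis. X p (w j) *\<^sub>R H j (F p))
          + h (F p) (H i (F p)) (\<Sum>j\<in>Basis. w j p *\<^sub>R DF X (H j \<circ> F) p)"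
        unfolding expand_W
        by (rule N.g_add_right) (auto intro!: tangent_space_intros HT DT i)
      also have "\<dots> = (\<Sum>j\<in>Basis.
          X p (w j) * h (F p) (H i (F p)) (H j (F p)) + w j p * h (F p) (H i (F p)) (DF X (H j \<circ> F) p))"
        by (simp add: N.g_sum_right[OF HT[OF i] HT] N.g_sum_right[OF HT[OF i] DT] sum.distrib)
      finally show "v i p * h (F p) (H i (F p)) (DF X W p) = (\<Sum>j\<in>Basis. v i p *
        (X p (w j) * h (F p) (H i (F p)) (H j (F p)) + w j p * h (F p) (H i (F p)) (DF X (H j \<circ> F) p)))"
        by (simp add: sum_distrib_left)
    qed
    finally show ?thesis by simp
  qed
  finally show ?thesis .
qed

end

section \<open>Conformal submersions without vertical vectors\<close>

locale conformal_submersion = pullback A B F h DN DF + M: riemannian A g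
  for A :: "('m::{t2_space, second_countable_topology}, 'a::euclidean_space) chart set"
    and B :: "('n::{t2_space, second_countable_topology}, 'b::euclidean_space) chart set"
    and F :: "'m \<Rightarrow> 'n" and g :: "'m \<Rightarrow> 'm tvec \<Rightarrow> 'm tvec \<Rightarrow> real"
    and h :: "'n \<Rightarrow> 'n tvec \<Rightarrow> 'n tvec \<Rightarrow> real"
    and DN :: "'n vfield \<Rightarrow> 'n vfield \<Rightarrow> 'n vfield"
    and DF :: "'m vfield \<Rightarrow> ('m \<Rightarrow> 'n tvec) \<Rightarrow> ('m \<Rightarrow> 'n tvec)" +
  fixes lam :: "'m \<Rightarrow> real" and DM :: "'m vfield \<Rightarrow> 'm vfield \<Rightarrow> 'm vfield"
  assumes levi_civita_M: "levi_civita A g DM"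
    and conformal: "horizontally_conformal_submersion A g B h F lam"
begin

lemma lam_smooth: "smooth_fun A lam" and lam_pos: "lam p > 0"
  using conformal unfolding horizontally_conformal_submersion_def by blast+

lemma DM_field: "X \<in> vector_fields A \<Longrightarrow> Y \<in> vector_fields A \<Longrightarrow> DM X Y \<in> vector_fields A"
  using affine_connectionD(1)[OF levi_civitaD(1)[OF levi_civita_M]] .

abbreviation sff :: "'m vfield \<Rightarrow> 'm vfield \<Rightarrow> 'm \<Rightarrow> 'n tvec"
  where "sff \<equiv> second_fundamental_form B F DM DF"

lemma sff_tangent:
  assumes "X \<in> vector_fields A" "Y \<in> vector_fields A"
  shows "sff X Y p \<in> tangent_space B (F p)"
  unfolding second_fundamental_form_def
  by (intro tangent_space_intros fields_alongD(1)[OF DF_fields[OF assms(1) fields_along_push[OF assms(2)]]]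
      push_tangent vector_field_tangent DM_field assms)

text \<open>Both connections are torsion free, so the skew parts of the two terms are the push of the same
  bracket.\<close>

lemma sff_symmetric:
  assumes X: "X \<in> vector_fields A" and Y: "Y \<in> vector_fields A"
  shows "sff X Y p = sff Y X p"
proof -
  have br: "lie_bracket X Y p = DM X Y p - DM Y X p"
    using levi_civitaD(2)[OF levi_civita_M X Y] by (metis minus_apply)
  have "lie_bracket X Y p \<in> tangent_space A p"
    unfolding br by (intro tangent_space_intros vector_field_tangent DM_field X Y)
  from DF_torsion_free[OF X Y this] show ?thesis
    unfolding second_fundamental_form_def br pushforward_diff by (simp add: algebra_simps)
qed

context
  assumes no_vertical: "\<And>p. vertical A B F p = {0}"
begin

lemma horizontal_eq: "horizontal A g B F p = tangent_space A p"
  using M.g_zero_right by (auto simp: orth_complement_def no_vertical)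

lemma conformal_fields:
  assumes "X \<in> vector_fields A" "Y \<in> vector_fields A"
  shows "h (F p) (push (X p)) (push (Y p)) = (lam p)\<^sup>2 * g p (X p) (Y p)"
proof -
  have "X \<in> sections_of A (horizontal A g B F)" "Y \<in> sections_of A (horizontal A g B F)"
    unfolding sections_of_def horizontal_eq using assms by (auto intro: vector_field_tangent)
  then show ?thesis using conformal unfolding horizontally_conformal_submersion_def by force
qed

lemma hor_proj_eq: "(\<And>p. E p \<in> tangent_space A p) \<Longrightarrow> hor_proj A g B F E = E"
proof
  fix p assume E: "\<And>p. E p \<in> tangent_space A p"
  have "E p - hor_proj A g B F E p \<in> vertical A B F p"
    by (rule M.hor_proj_decomposition(2)[OF subspace_vertical E])
  then show "hor_proj A g B F E p = E p" by (simp add: no_vertical)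
qed

lemma vert_proj_eq: "(\<And>p. E p \<in> tangent_space A p) \<Longrightarrow> vert_proj A g B F E = 0"
  unfolding vert_proj_def by (rule ext) (auto simp: no_vertical horizontal_eq)

text \<open>Differentiate the conformality relation \<open>h(push Y, push Z) = lam\<^sup>2 g(Y, Z)\<close> along \<open>X\<close>, using that
  \<open>DF\<close> and \<open>DM\<close> are metric: the covariant derivatives of \<open>Y\<close> and \<open>Z\<close> combine to the second fundamental
  form, and the derivative of the factor \<open>lam\<^sup>2\<close> remains.\<close>

lemma sff_metric:
  assumes X: "X \<in> vector_fields A" and Y: "Y \<in> vector_fields A" and Z: "Z \<in> vector_fields A"
  shows "h (F p) (sff X Y p) (push (Z p)) + h (F p) (push (Y p)) (sff X Z p)
    = 2 * lam p * X p lam * g p (Y p) (Z p)"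
proof -
  note tX = vector_field_tangent[OF X] and pt = push_tangent[OF vector_field_tangent]
  note gs = M.g_smooth[OF Y Z]
  have ll: "smooth_fun A (\<lambda>q. lam q * lam q)" by (rule smooth_fun_mult[OF dom lam_smooth lam_smooth])
  have eq: "(\<lambda>q. h (F q) (push (Y q)) (push (Z q))) = (\<lambda>q. lam q * lam q * g q (Y q) (Z q))"
    using conformal_fields[OF Y Z] by (simp add: power2_eq_square)
  have "X p (\<lambda>q. h (F q) (push (Y q)) (push (Z q)))
      = h (F p) (DF X (\<lambda>q. push (Y q)) p) (push (Z p)) + h (F p) (push (Y p)) (DF X (\<lambda>q. push (Z q)) p)"
    by (rule DF_metric[OF X fields_along_push[OF Y] fields_along_push[OF Z]])
      (simp only: eq smooth_fun_mult[OF dom ll gs])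
  moreover have "X p (\<lambda>q. h (F q) (push (Y q)) (push (Z q)))
      = 2 * lam p * X p lam * g p (Y p) (Z p) + (lam p)\<^sup>2 * g p (DM X Y p) (Z p) + (lam p)\<^sup>2 * g p (Y p) (DM X Z p)"
    unfolding eq
    using tangent_mult[OF tX ll gs] tangent_mult[OF tX lam_smooth lam_smooth]
      levi_civitaD(3)[OF levi_civita_M X Y Z, of p]
    by (simp add: power2_eq_square algebra_simps)
  moreover have "h (F p) (sff X Y p) (push (Z p))
      = h (F p) (DF X (\<lambda>q. push (Y q)) p) (push (Z p)) - (lam p)\<^sup>2 * g p (DM X Y p) (Z p)"
    unfolding second_fundamental_form_def conformal_fields[OF DM_field[OF X Y] Z, symmetric]
    by (rule N.g_diff_left[OF pt[OF Z] fields_alongD(1)[OF DF_fields[OF X fields_along_push[OF Y]]] pt[OF DM_field[OF X Y]]])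
  moreover have "h (F p) (push (Y p)) (sff X Z p)
      = h (F p) (push (Y p)) (DF X (\<lambda>q. push (Z q)) p) - (lam p)\<^sup>2 * g p (Y p) (DM X Z p)"
    unfolding second_fundamental_form_def conformal_fields[OF Y DM_field[OF X Z], symmetric]
    by (rule N.g_diff_right[OF pt[OF Y] fields_alongD(1)[OF DF_fields[OF X fields_along_push[OF Z]]] pt[OF DM_field[OF X Z]]])
  ultimately show ?thesis by linarith
qed

lemma homothetic_iff: "horizontally_homothetic A g B F lam \<longleftrightarrow> (\<forall>p. \<forall>w\<in>tangent_space A p. w lam = 0)"
proof -
  note grad = M.gradient_properties[OF lam_smooth]
  have "horizontally_homothetic A g B F lam \<longleftrightarrow> (\<forall>p. gradient A g lam p = 0)"
    unfolding horizontally_homothetic_def hor_proj_eq[OF grad(1)] by (simp add: fun_eq_iff)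
  also have "\<dots> \<longleftrightarrow> (\<forall>p. \<forall>w\<in>tangent_space A p. w lam = 0)"
  proof (intro iffI allI ballI)
    fix p w assume "\<forall>p. gradient A g lam p = 0" "w \<in> tangent_space A p"
    then show "w lam = 0" using grad(2)[of w p] M.g_zero_left by simp
  next
    fix p assume "\<forall>p. \<forall>w\<in>tangent_space A p. w lam = 0"
    then show "gradient A g lam p = 0" using grad(2)[OF grad(1)] grad(1) M.g_eq_0 by metis
  qed
  finally show ?thesis .
qed

text \<open>From left to right, \<open>sff_metric\<close> with three equal arguments \<open>W\<close> gives \<open>w lam * g(w, w) = 0\<close>.
  From right to left, a trilinear form that is symmetric in two arguments and skew in two others is equal to
  its own negative after six exchanges.\<close>

theorem totally_geodesic_iff_homothetic:
  "totally_geodesic A B F DM DF \<longleftrightarrow> horizontally_homothetic A g B F lam"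
  unfolding homothetic_iff
proof (intro iffI allI ballI)
  fix p w assume tg: "totally_geodesic A B F DM DF" and w: "w \<in> tangent_space A p"
  obtain W where W: "W \<in> vector_fields A" "W p = w" using extend_tangent_vector[OF dom w] .
  have "sff W W p = 0" using tg W(1) unfolding totally_geodesic_def by simp
  then have "2 * lam p * w lam * g p w w = 0"
    using sff_metric[OF W(1) W(1) W(1), of p] W(2)
    by (simp add: N.g_zero_left N.g_zero_right push_tangent w)
  then have "w lam = 0 \<or> w = 0" using lam_pos[of p] M.g_eq_0[OF w] by auto
  then show "w lam = 0" by auto
next
  assume hom: "\<forall>p. \<forall>w\<in>tangent_space A p. w lam = 0"
  show "totally_geodesic A B F DM DF"
    unfolding totally_geodesic_def
  proof (intro ballI ext)
    fix X Y p f assume X: "X \<in> vector_fields A" and Y: "Y \<in> vector_fields A"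
    let ?C = "\<lambda>X Y Z. h (F p) (sff X Y p) (push (Z p))"
    have anti: "?C X Y Z = - ?C X Z Y"
      if "X \<in> vector_fields A" "Y \<in> vector_fields A" "Z \<in> vector_fields A" for X Y Z
    proof -
      have "X p lam = 0" using hom vector_field_tangent[OF that(1)] by blast
      then show ?thesis
        using sff_metric[OF that, of p]
          N.g_sym[OF sff_tangent[OF that(1,3)] push_tangent[OF vector_field_tangent[OF that(2)]], of p] by simp
    qed
    obtain z where z: "z \<in> tangent_space A p" "push z = sff X Y p" using push_surj[OF sff_tangent[OF X Y]] by blast
    obtain Z where Z: "Z \<in> vector_fields A" "Z p = z" using extend_tangent_vector[OF dom z(1)] .
    \<comment> \<open>Alternate the skew and the symmetric exchange, three times each, to return to the start.\<close>
    have "?C X Y Z = - ?C X Y Z"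
      using anti[OF X Y Z(1)] anti[OF Z(1) X Y] anti[OF Y Z(1) X]
        sff_symmetric[OF X Y, of p] sff_symmetric[OF X Z(1), of p] sff_symmetric[OF Y Z(1), of p] by simp
    then have "h (F p) (sff X Y p) (sff X Y p) = 0" using Z z by simp
    then have "sff X Y p = 0" by (rule N.g_eq_0[OF sff_tangent[OF X Y]])
    then show "sff X Y p f = 0 p f" by simp
  qed
qed

end

end

section \<open>Vertical fields on a Sasakian manifold\<close>

lemma sasakianD:
  assumes "sasakian_manifold A \<phi> \<xi> \<eta> g D"
  shows "riemannian_manifold A g" "tensor_field_1_1 A \<phi>" "\<xi> \<in> vector_fields A" "levi_civita A g D"
    "\<And>p. \<phi> p (\<xi> p) = 0" "\<And>p. \<eta> p (\<xi> p) = 1"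
    "\<And>p v. v \<in> tangent_space A p \<Longrightarrow> \<eta> p (\<phi> p v) = 0"
    "\<And>p v. v \<in> tangent_space A p \<Longrightarrow> \<phi> p (\<phi> p v) = - v + \<eta> p v *\<^sub>R \<xi> p"
    "\<And>p v w. v \<in> tangent_space A p \<Longrightarrow> w \<in> tangent_space A p \<Longrightarrow>
       g p (\<phi> p v) (\<phi> p w) = g p v w - \<eta> p v * \<eta> p w"
    "\<And>X. X \<in> vector_fields A \<Longrightarrow> D X \<xi> = apply_endo \<phi> X"
  using assms unfolding sasakian_manifold_def almost_contact_metric_manifold_def almost_contact_metric_def
  by blast+

lemma tensor_fieldD:
  assumes "tensor_field_1_1 A \<phi>"
  shows "v \<in> tangent_space A p \<Longrightarrow> \<phi> p v \<in> tangent_space A p"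
    "X \<in> vector_fields A \<Longrightarrow> apply_endo \<phi> X \<in> vector_fields A" "\<phi> p 0 = 0"
proof -
  show "v \<in> tangent_space A p \<Longrightarrow> \<phi> p v \<in> tangent_space A p"
    "X \<in> vector_fields A \<Longrightarrow> apply_endo \<phi> X \<in> vector_fields A"
    using assms unfolding tensor_field_1_1_def by blast+
  have "\<phi> p (0 *\<^sub>R 0) = 0 *\<^sub>R \<phi> p 0"
    using assms tangent_space_intros(5)[of A p] unfolding tensor_field_1_1_def linear_at_def by blast
  then show "\<phi> p 0 = 0" by simp
qed

lemma eta_eq:
  assumes S: "sasakian_manifold A \<phi> \<xi> \<eta> g D" and v: "v \<in> tangent_space A p"
  shows "\<eta> p v = g p v (\<xi> p)"
proof -
  interpret riemannian A g by unfold_locales (rule sasakianD(1)[OF S])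
  have "g p (\<phi> p v) (\<phi> p (\<xi> p)) = g p v (\<xi> p) - \<eta> p v * \<eta> p (\<xi> p)"
    by (rule sasakianD(9)[OF S v vector_field_tangent[OF sasakianD(3)[OF S]]])
  then show ?thesis
    using g_zero_right[OF tensor_fieldD(1)[OF sasakianD(2)[OF S] v]]
    by (simp add: sasakianD(5)[OF S] sasakianD(6)[OF S])
qed

text \<open>Differentiate \<open>g(Y, \<xi>) = 0\<close> along \<open>X\<close> and insert \<open>\<nabla>\<^sub>X \<xi> = \<phi> X\<close>. Both arguments that
  exclude vertical vectors are instances of this identity.\<close>

lemma derivative_along_xi:
  assumes S: "sasakian_manifold A \<phi> \<xi> \<eta> g D" and X: "X \<in> vector_fields A" and Y: "Y \<in> vector_fields A"
    and orth: "\<And>q. g q (Y q) (\<xi> q) = 0"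
  shows "g p (D X Y p) (\<xi> p) = - g p (Y p) (\<phi> p (X p))"
proof -
  have "smooth_manifold A" using sasakianD(1)[OF S] unfolding riemannian_manifold_def by blast
  then have "X p (\<lambda>q. g q (Y q) (\<xi> q)) = 0" using tangent_const[OF _ vector_field_tangent[OF X], of p 0] orth by simp
  then show ?thesis
    using levi_civitaD(3)[OF sasakianD(4)[OF S] X Y sasakianD(3)[OF S], of p] sasakianD(10)[OF S X]
    by (simp add: apply_endo_def)
qed

text \<open>Vanishing of the second fundamental form on \<open>\<phi> V\<close> and \<open>V\<close> makes \<open>\<nabla>\<^sub>X V\<close> vertical for
  \<open>X = \<phi> V\<close>, hence orthogonal to \<open>\<xi>\<close>; but its product with \<open>\<xi>\<close> is \<open>- g(V, \<phi>\<^sup>2 V) = g(V, V)\<close>.\<close>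

lemma totally_geodesic_no_vertical:
  assumes S: "sasakian_manifold A \<phi> \<xi> \<eta> g DM"
    and CS: "pullback A B F h DN DF"
    and xi: "\<And>p. \<xi> p \<in> horizontal A g B F p"
    and tg: "totally_geodesic A B F DM DF"
    and V: "V \<in> sections_of A (vertical A B F)"
  shows "V = 0"
proof
  fix p
  interpret riemannian A g by unfold_locales (rule sasakianD(1)[OF S])
  interpret pullback A B F h DN DF by (rule CS)
  let ?X = "apply_endo \<phi> V"
  have V': "V \<in> vector_fields A" "\<And>q. V q \<in> vertical A B F q" using V unfolding sections_of_def by auto
  note VT = vector_field_tangent[OF V'(1)]
  have X: "?X \<in> vector_fields A" by (rule tensor_fieldD(2)[OF sasakianD(2)[OF S] V'(1)])
  have xiT: "\<xi> q \<in> T q" for q by (rule vector_field_tangent[OF sasakianD(3)[OF S]])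
  have orth: "g q v (\<xi> q) = 0" if "v \<in> vertical A B F q" for q v
    using xi[of q] that g_sym[of v q "\<xi> q"] xiT by (auto simp: orth_complement_def vertical_def)
  have V_xi: "g q (V q) (\<xi> q) = 0" for q by (rule orth[OF V'(2)])
  have "(\<lambda>q. push (V q)) = 0" using V'(2) by (auto simp: vertical_def)
  moreover have "second_fundamental_form B F DM DF ?X V p = 0"
    using tg X V'(1) unfolding totally_geodesic_def by simp
  ultimately have "push (DM ?X V p) = 0"
    unfolding second_fundamental_form_def by (simp add: DF_0[OF X])
  then have "DM ?X V p \<in> vertical A B F p"
    using vector_field_tangent[OF affine_connectionD(1)[OF levi_civitaD(1)[OF sasakianD(4)[OF S]] X V'(1)]]
    by (simp add: vertical_def)
  from orth[OF this] have "g p (V p) (\<phi> p (\<phi> p (V p))) = 0"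
    using derivative_along_xi[OF S, OF X, OF V'(1), OF V_xi, of p] by (simp add: apply_endo_def)
  moreover have "\<phi> p (\<phi> p (V p)) = (-1) *\<^sub>R V p"
    using sasakianD(8)[OF S VT] eta_eq[OF S VT] V_xi by simp
  ultimately have "g p (V p) (V p) = 0" using g_scale_right[OF VT VT, of p "-1"] by simp
  then show "V p = 0 p" using g_eq_0[OF VT] by simp
qed

text \<open>The vertical part of \<open>\<nabla>\<^sub>V \<phi> V\<close> and its horizontal part in \<open>\<phi> (ker \<pi>\<^sub>*)\<close> are both orthogonal
  to \<open>\<xi>\<close>; but the product of \<open>\<nabla>\<^sub>V \<phi> V\<close> with \<open>\<xi>\<close> is \<open>- g(\<phi> V, \<phi> V) = - g(V, V)\<close>.\<close>

lemma hor_image_no_vertical: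
  assumes S: "sasakian_manifold A \<phi> \<xi> \<eta> g DM"
    and xi: "\<And>p. \<xi> p \<in> horizontal A g B F p"
    and V: "V \<in> sections_of A (vertical A B F)"
    and a: "hor_proj A g B F (DM V (apply_endo \<phi> V)) \<in> sections_of A (\<lambda>p. \<phi> p ` vertical A B F p)"
  shows "V = 0"
proof
  fix p
  interpret riemannian A g by unfold_locales (rule sasakianD(1)[OF S])
  let ?X = "apply_endo \<phi> V" and ?H = "hor_proj A g B F (DM V (apply_endo \<phi> V)) p"
  have V': "V \<in> vector_fields A" "\<And>q. V q \<in> vertical A B F q" using V unfolding sections_of_def by auto
  note VT = vector_field_tangent[OF V'(1)]
  have X: "?X \<in> vector_fields A" by (rule tensor_fieldD(2)[OF sasakianD(2)[OF S] V'(1)])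
  have xiT: "\<xi> q \<in> T q" for q by (rule vector_field_tangent[OF sasakianD(3)[OF S]])
  have orth: "g q v (\<xi> q) = 0" if "v \<in> vertical A B F q" for q v
    using xi[of q] that g_sym[of v q "\<xi> q"] xiT by (auto simp: orth_complement_def vertical_def)
  have phi_xi: "g q (\<phi> q v) (\<xi> q) = 0" if "v \<in> T q" for q v
    using eta_eq[OF S tensor_fieldD(1)[OF sasakianD(2)[OF S] that]] sasakianD(7)[OF S that] by simp
  have X_xi: "g q (?X q) (\<xi> q) = 0" for q using phi_xi[OF VT] by (simp add: apply_endo_def)
  have DT: "DM V ?X p \<in> T p"
    by (rule vector_field_tangent[OF affine_connectionD(1)[OF levi_civitaD(1)[OF sasakianD(4)[OF S]] V'(1) X]])
  obtain w where w: "w \<in> vertical A B F p" "?H = \<phi> p w" using a unfolding sections_of_def by blast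
  then have wT: "w \<in> T p" by (simp add: vertical_def)
  have d: "DM V ?X p - ?H \<in> vertical A B F p"
    by (rule hor_proj_decomposition(2)[where E="DM V ?X", OF subspace_vertical DT])
  have HT: "?H \<in> T p" unfolding w(2) by (rule tensor_fieldD(1)[OF sasakianD(2)[OF S] wT])
  have "g p (DM V ?X p) (\<xi> p) = 0"
    using orth[OF d] g_diff_left[OF xiT DT HT] phi_xi[OF wT] w(2) by simp
  then have "g p (\<phi> p (V p)) (\<phi> p (V p)) = 0"
    using derivative_along_xi[OF S, OF V'(1), OF X, OF X_xi, of p] by (simp add: apply_endo_def)
  then have "g p (V p) (V p) = 0"
    using sasakianD(9)[OF S VT VT] eta_eq[OF S VT] orth[OF V'(2)] by simp
  then show "V p = 0 p" using g_eq_0[OF VT] by simp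
qed

section \<open>The characterization of totally geodesic maps\<close>

theorem theorem3p9:
  fixes A :: "('m::{t2_space, second_countable_topology}, 'a::euclidean_space) chart set"
    and B :: "('n::{t2_space, second_countable_topology}, 'b::euclidean_space) chart set"
    and \<phi> :: "'m \<Rightarrow> 'm tvec \<Rightarrow> 'm tvec"
    and \<xi> :: "'m vfield"
    and \<eta> :: "'m \<Rightarrow> 'm tvec \<Rightarrow> real"
    and gM :: "'m \<Rightarrow> 'm tvec \<Rightarrow> 'm tvec \<Rightarrow> real"
    and gN :: "'n \<Rightarrow> 'n tvec \<Rightarrow> 'n tvec \<Rightarrow> real"
    and \<pi> :: "'m \<Rightarrow> 'n"
    and dil :: "'m \<Rightarrow> real"
    and DM :: "'m vfield \<Rightarrow> 'm vfield \<Rightarrow> 'm vfield"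
    and DN :: "'n vfield \<Rightarrow> 'n vfield \<Rightarrow> 'n vfield"
    and D\<pi> :: "'m vfield \<Rightarrow> ('m \<Rightarrow> 'n tvec) \<Rightarrow> ('m \<Rightarrow> 'n tvec)"
  assumes "sasakian_manifold A \<phi> \<xi> \<eta> gM DM"
    and "riemannian_manifold B gN"
    and "levi_civita B gN DN"
    and "conformal_anti_invariant_xi_perp_submersion A \<phi> \<xi> \<eta> gM B gN \<pi> dil"
    and "pullback_connection A B \<pi> DN D\<pi>"
  shows "totally_geodesic A B \<pi> DM D\<pi> \<longleftrightarrow>
    (\<forall>U\<in>sections_of A (vertical A B \<pi>). \<forall>V\<in>sections_of A (vertical A B \<pi>).
        oneill_T A gM B \<pi> DM U (apply_endo \<phi> V) = 0 \<and>
        hor_proj A gM B \<pi> (DM U (apply_endo \<phi> V))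
          \<in> sections_of A (\<lambda>p. \<phi> p ` vertical A B \<pi> p)) \<and>
    horizontally_homothetic A gM B \<pi> dil \<and>
    (\<forall>Z\<in>sections_of A (horizontal A gM B \<pi>). \<forall>V\<in>sections_of A (vertical A B \<pi>).
        oneill_A A gM B \<pi> DM Z (apply_endo \<phi> V) = 0 \<and>
        hor_proj A gM B \<pi> (DM Z (apply_endo \<phi> V))
          \<in> sections_of A (\<lambda>p. \<phi> p ` vertical A B \<pi> p))"
    (is "?tg \<longleftrightarrow> ?a \<and> ?b \<and> ?c")
proof -
  note S = assms(1)
  have conf: "horizontally_conformal_submersion A gM B gN \<pi> dil" and xi: "\<And>p. \<xi> p \<in> horizontal A gM B \<pi> p"
    using assms(4) unfolding conformal_anti_invariant_xi_perp_submersion_def by blast+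
  interpret conformal_submersion A B \<pi> gM gN DN D\<pi> dil DM
    using assms(2,3,5) sasakianD(1,4)[OF S] conf
    by unfold_locales (auto simp: riemannian_manifold_def horizontally_conformal_submersion_def)
  note phi = tensor_fieldD[OF sasakianD(2)[OF S]]
  \<comment> \<open>Without vertical fields, (a) and (c) hold trivially, and (b) is equivalent to being totally geodesic.\<close>
  have main: "?tg \<longleftrightarrow> ?a \<and> ?b \<and> ?c" if zero: "\<And>V. V \<in> sections_of A (vertical A B \<pi>) \<Longrightarrow> V = 0"
  proof -
    have nv: "vertical A B \<pi> p = {0}" for p
    proof (intro equalityI subsetI)
      fix v assume v: "v \<in> vertical A B \<pi> p"
      obtain V where "V \<in> sections_of A (vertical A B \<pi>)" "V p = v" using extend_vertical_vector[OF v] .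
      then show "v \<in> {0}" using zero[of V] by simp
    next
      fix v :: "'m tvec" assume "v \<in> {0}"
      then show "v \<in> vertical A B \<pi> p" using subspace_0[OF subspace_vertical, of A B \<pi> p] by simp
    qed
    have hp: "hor_proj A gM B \<pi> X = X" and vp: "vert_proj A gM B \<pi> X = 0" if "X \<in> vector_fields A" for X
      using hor_proj_eq[OF nv vector_field_tangent[OF that]] vert_proj_eq[OF nv vector_field_tangent[OF that]] .
    note z = vector_field_0[OF dom]
    have D0: "DM X 0 = 0" if "X \<in> vector_fields A" for X
      by (rule affine_connection_zero_right[OF dom levi_civitaD(1)[OF levi_civita_M] that])
    have phi0: "apply_endo \<phi> 0 = 0" by (simp add: apply_endo_def phi(3) fun_eq_iff)
    have sec0: "0 \<in> sections_of A (\<lambda>p. \<phi> p ` vertical A B \<pi> p)"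
      using z by (auto simp: sections_of_def nv phi(3))
    have ?a
    proof (intro ballI)
      fix U V assume "U \<in> sections_of A (vertical A B \<pi>)" "V \<in> sections_of A (vertical A B \<pi>)"
      then have "U = 0" "V = 0" using zero by blast+
      then show "oneill_T A gM B \<pi> DM U (apply_endo \<phi> V) = 0 \<and>
        hor_proj A gM B \<pi> (DM U (apply_endo \<phi> V)) \<in> sections_of A (\<lambda>p. \<phi> p ` vertical A B \<pi> p)"
        by (simp add: phi0 oneill_T_def hp[OF z] vp[OF z] D0[OF z] sec0)
    qed
    moreover have ?c
    proof (intro ballI)
      fix Z V assume "Z \<in> sections_of A (horizontal A gM B \<pi>)" "V \<in> sections_of A (vertical A B \<pi>)"
      then have "Z \<in> vector_fields A" "V = 0" using zero unfolding sections_of_def by blast+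
      then show "oneill_A A gM B \<pi> DM Z (apply_endo \<phi> V) = 0 \<and>
        hor_proj A gM B \<pi> (DM Z (apply_endo \<phi> V)) \<in> sections_of A (\<lambda>p. \<phi> p ` vertical A B \<pi> p)"
        by (simp add: phi0 oneill_A_def hp vp z D0 sec0)
    qed
    ultimately show ?thesis using totally_geodesic_iff_homothetic[OF nv] by blast
  qed
  have "V = 0" if ?tg "V \<in> sections_of A (vertical A B \<pi>)" for V
    using totally_geodesic_no_vertical[OF S pullback_axioms xi that] .
  moreover have "V = 0" if ?a "V \<in> sections_of A (vertical A B \<pi>)" for V
    using hor_image_no_vertical[OF S xi that(2)] that by blast
  ultimately show ?thesis using main by blast
qed

end
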